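(* There is an absolute constant $C>0$ such that the following holds. Let $f:\mathbb{R}^{m\times n}\to\mathbb{R}$ be a differentiable convex function with condition number $\kappa$, and consider the low rank minimization problem $\min_{\operatorname{rank}(A)\le r} f(A)$, where $r\ge1$. For any error parameter $\varepsilon>0$ there exists a polynomial time algorithm that returns a matrix $A\in\mathbb{R}^{m\times n}$ with $$\operatorname{rank}(A)\le C\, r\left(\kappa+\log\frac{f(O)-f(A^* )}{\varepsilon}\right)\qquad\text{and}\qquad f(A)\le f(A^* )+\varepsilon,$$ where $O$ is the all-zero matrix and $A^*$ is any rank-$r$ matrix in $\mathbb{R}^{m\times n}$. (The logarithm is read as $0$ when $f(O)-f(A^* )\le\varepsilon$.)
   Context: With the Frobenius inner product $\langle A,B\rangle=\operatorname{Tr}(A^\top B)$ and Frobenius norm $\|\cdot\|_F$, a differentiable $f$ is $\beta$-smooth if $f(B)\le f(A)+\langle\nabla f(A),B-A\rangle+(\beta/2)\|B-A\|_F^2$ for all $A,B$, and $\alpha$-strongly convex if $f(B)\ge f(A)+\langle\nabla f(A),B-A\rangle+(\alpha/2)\|B-A\|_F^2$ for all $A,B$. The condition number of a $\beta$-smooth, $\alpha$-strongly convex function is $\kappa=\beta/\alpha$. Computational model: evaluations of $f$ and $\nabla f$, singular value decompositions, and exact minimization of a convex function of the form $f(A)+\frac{\beta}{4}\left(\langle W,AA^\top\rangle+\langle Y,A^\top A\rangle\right)$ (with $W,Y$ positive semidefinite) over matrices $A=UXV^\top$ with $U,V$ fixed, are regarded as available operations; "polynomial time" means polynomially many operations in $m$,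 $n$, $\kappa$ and $\log\frac{f(O)-f(A^* )}{\varepsilon}$. The value $f(A^* )$ may be regarded as known to the algorithm (the paper removes this by binary search over its value). *)

theory Defs
  imports Complex_Main "Jordan_Normal_Form.DL_Rank"
begin

text \<open>
  The constants in the theorem do not depend on the dimensions, so these have to be quantified
  inside the formula; matrices in $\mathbb{R}^{m\times n}$ are therefore elements of
  \<^term>\<open>carrier_mat m n\<close>, and the rank of such a matrix is \<^const>\<open>vec_space.rank\<close> \<open>m\<close>.
\<close>


section \<open>Analysis on real matrices\<close>

definition frob_inner :: "real mat \<Rightarrow> real mat \<Rightarrow> real" where
  "frob_inner A B = (\<Sum>i<dim_col A. (transpose_mat A * B) $$ (i, i))"

definition frob_norm :: "real mat \<Rightarrow> real" where
  "frob_norm A = sqrt (frob_inner A A)"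

text \<open>Frechet differentiability at \<open>A\<close> with respect to the Frobenius norm, with gradient \<open>G\<close>.\<close>

definition has_gradient :: "nat \<Rightarrow> nat \<Rightarrow> (real mat \<Rightarrow> real) \<Rightarrow> real mat \<Rightarrow> real mat \<Rightarrow> bool" where
  "has_gradient m n f G A \<longleftrightarrow> G \<in> carrier_mat m n \<and>
     (\<forall>e>0. \<exists>d>0. \<forall>B\<in>carrier_mat m n. frob_norm (B - A) < d \<longrightarrow>
        \<bar>f B - f A - frob_inner G (B - A)\<bar> \<le> e * frob_norm (B - A))"

definition gradient_of :: "nat \<Rightarrow> nat \<Rightarrow> (real mat \<Rightarrow> real) \<Rightarrow> (real mat \<Rightarrow> real mat) \<Rightarrow> bool" where
  "gradient_of m n f f' \<longleftrightarrow> (\<forall>A\<in>carrier_mat m n. has_gradient m n f (f' A) A)"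

definition convex_fun :: "nat \<Rightarrow> nat \<Rightarrow> (real mat \<Rightarrow> real) \<Rightarrow> bool" where
  "convex_fun m n f \<longleftrightarrow> (\<forall>A\<in>carrier_mat m n. \<forall>B\<in>carrier_mat m n. \<forall>t. 0 \<le> t \<and> t \<le> 1 \<longrightarrow>
     f ((1 - t) \<cdot>\<^sub>m A + t \<cdot>\<^sub>m B) \<le> (1 - t) * f A + t * f B)"

text \<open>In the next two definitions \<open>f'\<close> is the gradient of \<open>f\<close>.\<close>

definition smooth_fun ::
  "nat \<Rightarrow> nat \<Rightarrow> (real mat \<Rightarrow> real) \<Rightarrow> (real mat \<Rightarrow> real mat) \<Rightarrow> real \<Rightarrow> bool" where
  "smooth_fun m n f f' \<beta> \<longleftrightarrow> (\<forall>A\<in>carrier_mat m n. \<forall>B\<in>carrier_mat m n.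
     f B \<le> f A + frob_inner (f' A) (B - A) + (\<beta> / 2) * (frob_norm (B - A))\<^sup>2)"

definition strongly_convex_fun ::
  "nat \<Rightarrow> nat \<Rightarrow> (real mat \<Rightarrow> real) \<Rightarrow> (real mat \<Rightarrow> real mat) \<Rightarrow> real \<Rightarrow> bool" where
  "strongly_convex_fun m n f f' \<alpha> \<longleftrightarrow> (\<forall>A\<in>carrier_mat m n. \<forall>B\<in>carrier_mat m n.
     f B \<ge> f A + frob_inner (f' A) (B - A) + (\<alpha> / 2) * (frob_norm (B - A))\<^sup>2)"

definition psd_mat :: "nat \<Rightarrow> real mat \<Rightarrow> bool" where
  "psd_mat k W \<longleftrightarrow> W \<in> carrier_mat k k \<and> transpose_mat W = W \<and>
     (\<forall>x\<in>carrier_vec k. 0 \<le> x \<bullet> (W *\<^sub>v x))"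

text \<open>Full singular value decomposition, singular values in nonincreasing order.\<close>

definition is_svd :: "real mat \<Rightarrow> real mat \<times> real mat \<times> real mat \<Rightarrow> bool" where
  "is_svd A USV \<longleftrightarrow> (case USV of (U, S, V) \<Rightarrow>
     U \<in> carrier_mat (dim_row A) (dim_row A) \<and> transpose_mat U * U = 1\<^sub>m (dim_row A) \<and>
     V \<in> carrier_mat (dim_col A) (dim_col A) \<and> transpose_mat V * V = 1\<^sub>m (dim_col A) \<and>
     S \<in> carrier_mat (dim_row A) (dim_col A) \<and> diagonal_mat S \<and>
     (\<forall>i<min (dim_row A) (dim_col A). 0 \<le> S $$ (i, i)) \<and>
     (\<forall>i j. i \<le> j \<and> j < min (dim_row A) (dim_col A) \<longrightarrow> S $$ (j, j) \<le> S $$ (i, i)) \<and>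
     A = U * S * transpose_mat V)"

definition regularized ::
  "(real mat \<Rightarrow> real) \<Rightarrow> real \<Rightarrow> real mat \<Rightarrow> real mat \<Rightarrow> real mat \<Rightarrow> real" where
  "regularized f \<beta> W Y A =
     f A + (\<beta> / 4) * (frob_inner W (A * transpose_mat A) + frob_inner Y (transpose_mat A * A))"

text \<open>\<open>A\<close> minimizes the regularized function over all matrices \<open>U * X * V\<^sup>T\<close>, with \<open>X\<close> arbitrary.\<close>

definition is_minimizer ::
  "(real mat \<Rightarrow> real) \<Rightarrow> real \<Rightarrow> real mat \<Rightarrow> real mat \<Rightarrow> real mat \<Rightarrow> real mat \<Rightarrow> real mat \<Rightarrow> bool" where
  "is_minimizer f \<beta> U V W Y A \<longleftrightarrow>
     (let F = {U * X * transpose_mat V | X. X \<in> carrier_mat (dim_col U) (dim_col V)}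
      in A \<in> F \<and> (\<forall>B\<in>F. regularized f \<beta> W Y A \<le> regularized f \<beta> W Y B))"


section \<open>The computational model\<close>

text \<open>
  Algorithms are finite while-programs over three unbounded files of registers, holding natural
  numbers, exact real numbers and real matrices. The objective function, its gradient, the singular
  value decomposition and the minimization are available only through the following record.
\<close>

record oracles =
  nrows :: nat
  ncols :: nat
  objective :: "real mat \<Rightarrow> real"
  gradient :: "real mat \<Rightarrow> real mat"
  svd :: "real mat \<Rightarrow> real mat \<times> real mat \<times> real mat"
  minimizer :: "real mat \<Rightarrow> real mat \<Rightarrow> real mat \<Rightarrow> real mat \<Rightarrow> real mat"

text \<open>
  Singular value decompositions are not unique; a program has to work with every choice function
  \<open>svd E\<close>. The functions are unconstrained outside the stated arguments.
\<close>

definition valid_oracles ::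
  "nat \<Rightarrow> nat \<Rightarrow> (real mat \<Rightarrow> real) \<Rightarrow> (real mat \<Rightarrow> real mat) \<Rightarrow> real \<Rightarrow> oracles \<Rightarrow> bool" where
  "valid_oracles m n f f' \<beta> E \<longleftrightarrow> nrows E = m \<and> ncols E = n \<and>
     (\<forall>A\<in>carrier_mat m n. objective E A = f A \<and> gradient E A = f' A) \<and>
     (\<forall>A. is_svd A (svd E A)) \<and>
     (\<forall>U V W Y. dim_row U = m \<and> dim_row V = n \<and> psd_mat m W \<and> psd_mat n Y \<longrightarrow>
        is_minimizer f \<beta> U V W Y (minimizer E U V W Y))"

record state =
  nreg :: "nat \<Rightarrow> nat"
  rreg :: "nat \<Rightarrow> real"
  mreg :: "nat \<Rightarrow> real mat"

text \<open>\<open>NRows a\<close> and \<open>NCols a\<close> are the dimensions of matrix register \<open>a\<close>.\<close>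

datatype nexp = NConst nat | NVar nat | NRows nat | NCols nat | NPlus nexp nexp | NMinus nexp nexp

datatype rexp = RConst int | RVar nat | ROfNat nexp
  | RPlus rexp rexp | RMinus rexp rexp | RTimes rexp rexp | RDivide rexp rexp

datatype bexp = BLess rexp rexp | BNot bexp | BAnd bexp bexp

primrec nval :: "nexp \<Rightarrow> state \<Rightarrow> nat" where
  "nval (NConst k) s = k"
| "nval (NVar i) s = nreg s i"
| "nval (NRows a) s = dim_row (mreg s a)"
| "nval (NCols a) s = dim_col (mreg s a)"
| "nval (NPlus d e) s = nval d s + nval e s"
| "nval (NMinus d e) s = nval d s - nval e s"

primrec rval :: "rexp \<Rightarrow> state \<Rightarrow> real" where
  "rval (RConst k) s = of_int k"
| "rval (RVar i) s = rreg s i"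
| "rval (ROfNat e) s = real (nval e s)"
| "rval (RPlus d e) s = rval d s + rval e s"
| "rval (RMinus d e) s = rval d s - rval e s"
| "rval (RTimes d e) s = rval d s * rval e s"
| "rval (RDivide d e) s = rval d s / rval e s"

primrec bval :: "bexp \<Rightarrow> state \<Rightarrow> bool" where
  "bval (BLess d e) s \<longleftrightarrow> rval d s < rval e s"
| "bval (BNot b) s \<longleftrightarrow> \<not> bval b s"
| "bval (BAnd b c) s \<longleftrightarrow> bval b s \<and> bval c s"

datatype instr =
    NAssign nat nexp
  | RAssign nat rexp
  | GetEntry nat nat nexp nexp
  | SetEntry nat nexp nexp rexp
  | Zero nat nexp nexp
  | Identity nat nexp
  | Copy nat nat
  | Transpose nat nat
  | Scale nat rexp nat
  | Sum nat nat nat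
  | Product nat nat nat
  | Columns nat nat nexp nexp
  | Append nat nat nat
  | Objective nat nat
  | Gradient nat nat
  | SVD nat nat nat nat
  | Minimize nat nat nat nat nat

abbreviation set_nreg :: "nat \<Rightarrow> nat \<Rightarrow> state \<Rightarrow> state" where
  "set_nreg x v s \<equiv> s\<lparr>nreg := (nreg s)(x := v)\<rparr>"

abbreviation set_rreg :: "nat \<Rightarrow> real \<Rightarrow> state \<Rightarrow> state" where
  "set_rreg x v s \<equiv> s\<lparr>rreg := (rreg s)(x := v)\<rparr>"

abbreviation set_mreg :: "nat \<Rightarrow> real mat \<Rightarrow> state \<Rightarrow> state" where
  "set_mreg x v s \<equiv> s\<lparr>mreg := (mreg s)(x := v)\<rparr>"

text \<open>
  The first argument(s) of an instruction are the destination. The result is the new state together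
  with the cost, or \<open>None\<close> if the operands do not fit, in which case the program is stuck.
  A matrix instruction is charged for the entries it writes, and a product for its scalar
  multiplications, so that a program of polynomial cost only handles matrices of polynomial size.
  Scalar instructions have cost 1, as the size of their expressions is fixed by the program.
\<close>

fun exec :: "oracles \<Rightarrow> instr \<Rightarrow> state \<Rightarrow> (state \<times> nat) option" where
  "exec E (NAssign x e) s = Some (set_nreg x (nval e s) s, 1)"
| "exec E (RAssign x e) s = Some (set_rreg x (rval e s) s, 1)"
| "exec E (GetEntry x a d e) s =
     (let A = mreg s a; i = nval d s; j = nval e s in
      if i < dim_row A \<and> j < dim_col A then Some (set_rreg x (A $$ (i, j)) s, 1) else None)"
| "exec E (SetEntry a d e v) s =
     (let A = mreg s a; i = nval d s; j = nval e s in
      if i < dim_row A \<and> j < dim_col A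
      then Some (set_mreg a (mat (dim_row A) (dim_col A)
             (\<lambda>p. if p = (i, j) then rval v s else A $$ p)) s, 1)
      else None)"
| "exec E (Zero x d e) s =
     Some (set_mreg x (0\<^sub>m (nval d s) (nval e s)) s, 1 + nval d s * nval e s)"
| "exec E (Identity x e) s = Some (set_mreg x (1\<^sub>m (nval e s)) s, 1 + nval e s * nval e s)"
| "exec E (Copy x a) s =
     (let A = mreg s a in Some (set_mreg x A s, 1 + dim_row A * dim_col A))"
| "exec E (Transpose x a) s =
     (let A = mreg s a in Some (set_mreg x (transpose_mat A) s, 1 + dim_row A * dim_col A))"
| "exec E (Scale x v a) s =
     (let A = mreg s a in Some (set_mreg x (rval v s \<cdot>\<^sub>m A) s, 1 + dim_row A * dim_col A))"
| "exec E (Sum x a b) s =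
     (let A = mreg s a; B = mreg s b in
      if dim_row A = dim_row B \<and> dim_col A = dim_col B
      then Some (set_mreg x (A + B) s, 1 + dim_row A * dim_col A) else None)"
| "exec E (Product x a b) s =
     (let A = mreg s a; B = mreg s b in
      if dim_col A = dim_row B
      then Some (set_mreg x (A * B) s, 1 + dim_row A * (1 + dim_col A) * dim_col B) else None)"
| "exec E (Columns x a d e) s =
     (let A = mreg s a; k = nval d s; l = nval e s in
      if k \<le> l \<and> l \<le> dim_col A
      then Some (set_mreg x (mat (dim_row A) (l - k) (\<lambda>(i, j). A $$ (i, k + j))) s,
             1 + dim_row A * (l - k))
      else None)"
| "exec E (Append x a b) s =
     (let A = mreg s a; B = mreg s b in
      if dim_row A = dim_row B
      then Some (set_mreg x (mat (dim_row A) (dim_col A + dim_col B)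
             (\<lambda>(i, j). if j < dim_col A then A $$ (i, j) else B $$ (i, j - dim_col A))) s,
             1 + dim_row A * (dim_col A + dim_col B))
      else None)"
| "exec E (Objective x a) s =
     (let A = mreg s a in
      if A \<in> carrier_mat (nrows E) (ncols E) then Some (set_rreg x (objective E A) s, 1) else None)"
| "exec E (Gradient x a) s =
     (let A = mreg s a in
      if A \<in> carrier_mat (nrows E) (ncols E)
      then Some (set_mreg x (gradient E A) s, 1 + nrows E * ncols E) else None)"
| "exec E (SVD x y z a) s =
     (let A = mreg s a in case svd E A of (U, S, V) \<Rightarrow>
      Some (set_mreg z V (set_mreg y S (set_mreg x U s)),
        1 + dim_row A * dim_row A + dim_row A * dim_col A + dim_col A * dim_col A))"
| "exec E (Minimize x u v w y) s =
     (let U = mreg s u; V = mreg s v; W = mreg s w; Y = mreg s y in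
      if dim_row U = nrows E \<and> dim_row V = ncols E \<and> psd_mat (nrows E) W \<and> psd_mat (ncols E) Y
      then Some (set_mreg x (minimizer E U V W Y) s, 1 + nrows E * ncols E) else None)"

datatype prog = Do instr | Seq prog prog | If bexp prog prog | While bexp prog

text \<open>
  \<open>run E p s t s'\<close>: started in \<open>s\<close>, the program terminates in \<open>s'\<close> without getting stuck, with
  total cost \<open>t\<close>. The semantics is deterministic, so asserting that such a run exists is total
  correctness.
\<close>

inductive run :: "oracles \<Rightarrow> prog \<Rightarrow> state \<Rightarrow> nat \<Rightarrow> state \<Rightarrow> bool" for E where
  run_Do: "exec E i s = Some (s', t) \<Longrightarrow> run E (Do i) s t s'"
| run_Seq: "run E p s t s' \<Longrightarrow> run E q s' u s'' \<Longrightarrow> run E (Seq p q) s (t + u) s''"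
| run_IfTrue: "bval b s \<Longrightarrow> run E p s t s' \<Longrightarrow> run E (If b p q) s (1 + t) s'"
| run_IfFalse: "\<not> bval b s \<Longrightarrow> run E q s t s' \<Longrightarrow> run E (If b p q) s (1 + t) s'"
| run_WhileFalse: "\<not> bval b s \<Longrightarrow> run E (While b p) s 1 s"
| run_WhileTrue: "bval b s \<Longrightarrow> run E p s t s' \<Longrightarrow> run E (While b p) s' u s'' \<Longrightarrow>
    run E (While b p) s (1 + t + u) s''"

text \<open>
  The input consists of the dimensions, the target rank \<open>r\<close>, the strong convexity and smoothness
  constants, the error \<open>\<epsilon>\<close>, and the value \<open>fstar\<close> to compete with; \<open>f\<close> is accessed by oracle only.
\<close>

definition init_state :: "nat \<Rightarrow> nat \<Rightarrow> nat \<Rightarrow> real \<Rightarrow> real \<Rightarrow> real \<Rightarrow> real \<Rightarrow> state" where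
  "init_state m n r \<alpha> \<beta> \<epsilon> fstar =
     \<lparr>nreg = (\<lambda>_. 0)(0 := m, 1 := n, 2 := r),
      rreg = (\<lambda>_. 0)(0 := \<alpha>, 1 := \<beta>, 2 := \<epsilon>, 3 := fstar),
      mreg = (\<lambda>_. 0\<^sub>m 0 0)\<rparr>"

definition result_mat :: "state \<Rightarrow> real mat" where
  "result_mat s = mreg s 0"

text \<open>$\log\frac{\mathit{gap}}{\varepsilon}$, read as 0 when the gap is at most \<open>\<epsilon>\<close>.\<close>

definition log_gap :: "real \<Rightarrow> real \<Rightarrow> real" where
  "log_gap gap \<epsilon> = (if gap \<le> \<epsilon> then 0 else ln (gap / \<epsilon>))"

end

theory Submission
  imports Defs
begin

text \<open>
  The algorithm is projected gradient descent (iterative hard thresholding) on an adaptively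
  regularized objective. For \<open>A = U S V\<^sup>T\<close> the term \<open>(\<beta> / 2) \<Sum>i. \<omega> i (\<sigma> i)\<^sup>2\<close> is added to \<open>f\<close>, where
  the weights \<open>\<omega> i = min k (i - r) / k\<close> vanish on the \<open>r\<close> leading singular values and grow to 1 within
  \<open>k = O(\<kappa> r)\<close> steps. With \<open>W = U diag(\<omega>) U\<^sup>T\<close> the function \<open>f(X) + (\<beta> / 2) \<langle>X, W X\<rangle>\<close> is \<open>2 \<beta>\<close>-smooth and
  dominates the penalized objective, by Eckart--Young and because \<open>\<omega>\<close> is increasing; a step takes a
  gradient step for it and truncates to rank \<open>s = O(\<kappa> r)\<close>. The penalty forces the spectrum to decay, so
  that dropping the last \<open>r\<close> of \<open>s\<close> singular values costs only \<open>O(1 / \<kappa>)\<close> of the gap, while the inner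
  product of \<open>W A\<close> with a matrix of rank at most \<open>2 r\<close> is small because no single \<open>\<omega> i \<sigma> i\<close> is large. Hence
  the penalized gap shrinks by a factor \<open>1 - \<Omega>(1 / \<kappa>)\<close> in every step. The rank bound \<open>O(\<kappa> r)\<close> obtained in
  this way contains no logarithm, and the minimization oracle is not called.
\<close>


section \<open>Frobenius inner product\<close>

lemma frob_inner_entries:
  assumes "A \<in> carrier_mat m n" "B \<in> carrier_mat m n"
  shows "frob_inner A B = (\<Sum>i<m. \<Sum>j<n. A $$ (i, j) * B $$ (i, j))"
proof -
  have "frob_inner A B = (\<Sum>j<n. \<Sum>i<m. A $$ (i, j) * B $$ (i, j))"
    using assms unfolding frob_inner_def
    by (auto intro!: sum.cong simp: scalar_prod_def atLeast0LessThan)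
  then show ?thesis by (simp add: sum.swap[of _ "{..<n}"])
qed

lemma frob_inner_commute:
  assumes "A \<in> carrier_mat m n" "B \<in> carrier_mat m n"
  shows "frob_inner A B = frob_inner B A"
  using assms by (simp add: frob_inner_entries mult.commute)

lemma frob_inner_add_left:
  assumes "A \<in> carrier_mat m n" "B \<in> carrier_mat m n" "C \<in> carrier_mat m n"
  shows "frob_inner (A + B) C = frob_inner A C + frob_inner B C"
  using assms by (simp add: frob_inner_entries[of _ m n] distrib_right sum.distrib)

lemma frob_inner_minus_left:
  assumes "A \<in> carrier_mat m n" "B \<in> carrier_mat m n" "C \<in> carrier_mat m n"
  shows "frob_inner (A - B) C = frob_inner A C - frob_inner B C"
  using assms by (simp add: frob_inner_entries[of _ m n] left_diff_distrib sum_subtractf minus_carrier_mat)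

lemma frob_inner_smult_left:
  assumes "A \<in> carrier_mat m n" "C \<in> carrier_mat m n"
  shows "frob_inner (a \<cdot>\<^sub>m A) C = a * frob_inner A C"
  using assms by (simp add: frob_inner_entries[of _ m n] sum_distrib_left mult.assoc)

lemma frob_inner_add_right:
  assumes "A \<in> carrier_mat m n" "B \<in> carrier_mat m n" "C \<in> carrier_mat m n"
  shows "frob_inner C (A + B) = frob_inner C A + frob_inner C B"
  using assms by (simp add: frob_inner_entries[of _ m n] distrib_left sum.distrib)

lemma frob_inner_minus_right:
  assumes "A \<in> carrier_mat m n" "B \<in> carrier_mat m n" "C \<in> carrier_mat m n"
  shows "frob_inner C (A - B) = frob_inner C A - frob_inner C B"
  using assms by (simp add: frob_inner_entries[of _ m n] right_diff_distrib sum_subtractf minus_carrier_mat)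

lemma frob_inner_smult_right:
  assumes "A \<in> carrier_mat m n" "C \<in> carrier_mat m n"
  shows "frob_inner C (a \<cdot>\<^sub>m A) = a * frob_inner C A"
  using assms by (simp add: frob_inner_entries[of _ m n] sum_distrib_left mult.left_commute)

lemma frob_inner_nonneg:
  assumes "A \<in> carrier_mat m n"
  shows "0 \<le> frob_inner A A"
  using assms by (simp add: frob_inner_entries[of _ m n] sum_nonneg)

lemma frob_norm_power2:
  assumes "A \<in> carrier_mat m n"
  shows "(frob_norm A)\<^sup>2 = frob_inner A A"
  using frob_inner_nonneg[OF assms] by (simp add: frob_norm_def)

lemma frob_inner_adjoint:
  assumes "M \<in> carrier_mat p m" "A \<in> carrier_mat m n" "B \<in> carrier_mat p n"
  shows "frob_inner (M * A) B = frob_inner A (transpose_mat M * B)"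
proof -
  have "transpose_mat (M * A) * B = transpose_mat A * (transpose_mat M * B)"
    using assms by (simp add: transpose_mult[of _ p m _ n] assoc_mult_mat[of _ n m _ p _ n])
  then show ?thesis using assms by (simp add: frob_inner_def)
qed

lemmas frob_inner_linear = frob_inner_add_left frob_inner_add_right frob_inner_minus_left
  frob_inner_minus_right frob_inner_smult_left frob_inner_smult_right

text \<open>Expand the square of \<open>c A - B\<close> and divide by \<open>c\<close>. The free
  weight lets later estimates balance a small factor against a large one.\<close>

lemma young_frob_inner:
  assumes "A \<in> carrier_mat m n" "B \<in> carrier_mat m n" "c > 0"
  shows "2 * frob_inner A B \<le> c * frob_inner A A + frob_inner B B / c"
proof -
  have "0 \<le> frob_inner (c \<cdot>\<^sub>m A - B) (c \<cdot>\<^sub>m A - B)"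
    by (rule frob_inner_nonneg[of _ m n]) (use assms in \<open>auto simp: minus_carrier_mat\<close>)
  also have "\<dots> = c * (c * frob_inner A A) - 2 * c * frob_inner A B + frob_inner B B"
    using assms frob_inner_commute[OF assms(2,1)]
    by (simp add: frob_inner_linear[of _ m n] minus_carrier_mat algebra_simps)
  finally show ?thesis using assms(3) by (simp add: field_simps)
qed

lemma frob_inner_add_le:
  assumes "A \<in> carrier_mat m n" "B \<in> carrier_mat m n"
  shows "frob_inner (A + B) (A + B) \<le> 2 * frob_inner A A + 2 * frob_inner B B"
  using young_frob_inner[OF assms, of 1] frob_inner_commute[OF assms] assms
  by (simp add: frob_inner_linear[of _ m n])


section \<open>Matrices with a prescribed orthogonal diagonalization\<close>

definition orthogonal_basis :: "nat \<Rightarrow> real mat \<Rightarrow> bool" where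
  "orthogonal_basis m U \<longleftrightarrow> U \<in> carrier_mat m m \<and> transpose_mat U * U = 1\<^sub>m m"

text \<open>For orthogonal \<open>U\<close>, the symmetric matrix with the columns of
  \<open>U\<close> as eigenvectors and \<open>d\<close> as eigenvalues. One calculus thus covers
  spectral projections (0/1-valued \<open>d\<close>) and the weight matrix of the penalty.\<close>

definition conj_diag :: "nat \<Rightarrow> real mat \<Rightarrow> (nat \<Rightarrow> real) \<Rightarrow> real mat" where
  "conj_diag m U d = U * mat_diag m d * transpose_mat U"

text \<open>The \<open>i\<close>-th diagonal entry of \<open>U^T X X^T U\<close>; a squared singular
  value of \<open>X\<close> when \<open>U\<close> is a left singular basis.\<close>

definition row_energy :: "real mat \<Rightarrow> real mat \<Rightarrow> nat \<Rightarrow> real" where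
  "row_energy U X i = (\<Sum>j<dim_col X. ((transpose_mat U * X) $$ (i, j))\<^sup>2)"

abbreviation head_proj :: "nat \<Rightarrow> real mat \<Rightarrow> nat \<Rightarrow> real mat" where
  "head_proj m U l \<equiv> conj_diag m U (\<lambda>i. of_bool (i < l))"

abbreviation tail_proj :: "nat \<Rightarrow> real mat \<Rightarrow> nat \<Rightarrow> real mat" where
  "tail_proj m U l \<equiv> conj_diag m U (\<lambda>i. of_bool (l \<le> i))"

lemma orthogonal_basisD:
  assumes "orthogonal_basis m U"
  shows "U \<in> carrier_mat m m" "transpose_mat U * U = 1\<^sub>m m" "U * transpose_mat U = 1\<^sub>m m"
  using assms mat_mult_left_right_inverse[of "transpose_mat U" m U]
  by (auto simp: orthogonal_basis_def)

lemma mult_square_carrier [simp]: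
  "M \<in> carrier_mat m m \<Longrightarrow> X \<in> carrier_mat m n \<Longrightarrow> M * X \<in> carrier_mat m n"
  by (rule mult_carrier_mat)

lemma conj_diag_carrier [simp]:
  "U \<in> carrier_mat m m \<Longrightarrow> conj_diag m U d \<in> carrier_mat m m"
  by (auto simp: conj_diag_def)

lemma mat_diag_transpose [simp]: "transpose_mat (mat_diag m d) = (mat_diag m d :: real mat)"
  by (rule eq_matI) (auto simp: mat_diag_def)

lemma conj_diag_transpose [simp]:
  assumes "U \<in> carrier_mat m m"
  shows "transpose_mat (conj_diag m U d) = conj_diag m U d"
  using assms
  by (simp add: conj_diag_def transpose_mult[of _ m m _ m] assoc_mult_mat[of _ m m _ m _ m])

lemma conj_diag_apply:
  assumes "U \<in> carrier_mat m m" "X \<in> carrier_mat m n"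
  shows "conj_diag m U d * X = U * (mat_diag m d * (transpose_mat U * X))"
  using assms by (simp add: conj_diag_def assoc_mult_mat[of _ m m _ m _ m] assoc_mult_mat[of _ m m _ m _ n])

lemma orthogonal_cancel:
  assumes "orthogonal_basis m U" "X \<in> carrier_mat m n"
  shows "transpose_mat U * (U * X) = X" "U * (transpose_mat U * X) = X"
  using orthogonal_basisD[OF assms(1)] assms(2)
  by (simp_all flip: assoc_mult_mat[of _ m m _ m _ n])

lemma mat_diag_mat_diag_apply:
  "X \<in> carrier_mat m n \<Longrightarrow>
    mat_diag m d * (mat_diag m e * X) = (mat_diag m (\<lambda>i. d i * e i) * X :: real mat)"
  by (simp flip: assoc_mult_mat[of _ m m _ m _ n])

lemma conj_diag_mult_apply:
  assumes "orthogonal_basis m U" "X \<in> carrier_mat m n"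
  shows "conj_diag m U d * (conj_diag m U e * X) = conj_diag m U (\<lambda>i. d i * e i) * X"
  using orthogonal_basisD(1)[OF assms(1)] assms
  by (simp add: conj_diag_apply[of _ m _ n] orthogonal_cancel[of m _ _ n] mat_diag_mat_diag_apply[of _ _ n])

lemma conj_diag_const_1:
  assumes "orthogonal_basis m U"
  shows "conj_diag m U (\<lambda>_. 1) = 1\<^sub>m m"
  using orthogonal_basisD[OF assms] by (simp add: conj_diag_def)

lemma row_energy_nonneg: "0 \<le> row_energy U X i"
  by (simp add: row_energy_def sum_nonneg)

lemma frob_inner_conj_diag:
  assumes "U \<in> carrier_mat m m" "X \<in> carrier_mat m n"
  shows "frob_inner (conj_diag m U d * X) X = (\<Sum>i<m. d i * row_energy U X i)"
proof -
  let ?Y = "transpose_mat U * X"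
  have Y: "?Y \<in> carrier_mat m n" using assms by auto
  have "frob_inner (conj_diag m U d * X) X = frob_inner (mat_diag m d * ?Y) ?Y"
    using assms Y frob_inner_adjoint[of U m m "mat_diag m d * ?Y" n X]
    by (simp add: conj_diag_apply[of _ m _ n])
  also have "\<dots> = (\<Sum>i<m. d i * row_energy U X i)"
    using assms Y by (simp add: frob_inner_entries[of _ m n]
        mat_diag_mult_left[of _ m n] row_energy_def sum_distrib_left power2_eq_square mult.assoc)
  finally show ?thesis .
qed

lemma sum_row_energy:
  assumes "orthogonal_basis m U" "X \<in> carrier_mat m n"
  shows "(\<Sum>i<m. row_energy U X i) = frob_inner X X"
  using frob_inner_conj_diag[of U m X n "\<lambda>_. 1"] orthogonal_basisD[OF assms(1)] assms
  by (simp add: conj_diag_const_1)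

lemma frob_inner_conj_diag_idem:
  assumes "orthogonal_basis m U" "X \<in> carrier_mat m n"
  shows "frob_inner (conj_diag m U d * X) (conj_diag m U e * X) = (\<Sum>i<m. d i * e i * row_energy U X i)"
  using orthogonal_basisD(1)[OF assms(1)] assms
    frob_inner_adjoint[of "conj_diag m U e" m m X n "conj_diag m U d * X"]
    frob_inner_commute[of "conj_diag m U d * X" m n "conj_diag m U e * X"]
    frob_inner_commute[of X m n "conj_diag m U (\<lambda>x. e x * d x) * X"]
  by (simp add: conj_diag_mult_apply frob_inner_conj_diag mult.commute)


section \<open>Squared singular values as eigenvalues of \<open>X X^T\<close>\<close>

text \<open>This encodes \<open>X X^T = U diag(z) U^T\<close>, so that right singular vectors and
  the rectangular shape of the singular value matrix disappear. The sequence \<open>z\<close> has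
  length \<open>m\<close>; its ordering is a separate hypothesis wherever it matters.\<close>

definition diagonalizes :: "nat \<Rightarrow> real mat \<Rightarrow> (nat \<Rightarrow> real) \<Rightarrow> real mat \<Rightarrow> bool" where
  "diagonalizes m U z X \<longleftrightarrow> orthogonal_basis m U \<and>
     (transpose_mat U * X) * transpose_mat (transpose_mat U * X) = mat_diag m z"

text \<open>A product of orthogonal matrices is orthogonal, so its squared entries form a doubly
  stochastic matrix. This is what turns row energies in a second basis into averages.\<close>

lemma orthogonal_basis_overlap:
  assumes "orthogonal_basis m U" "orthogonal_basis m U'"
  defines "Q \<equiv> transpose_mat U * U'"
  shows "Q \<in> carrier_mat m m"
    "i < m \<Longrightarrow> (\<Sum>j<m. (Q $$ (i, j))\<^sup>2) = 1" "j < m \<Longrightarrow> (\<Sum>i<m. (Q $$ (i, j))\<^sup>2) = 1"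
proof -
  note U = orthogonal_basisD[OF assms(1)] and U' = orthogonal_basisD[OF assms(2)]
  show Q: "Q \<in> carrier_mat m m" using U U' by (simp add: Q_def)
  have "Q * transpose_mat Q = transpose_mat U * (U' * (transpose_mat U' * U))"
    using U(1) U'(1) by (simp add: Q_def transpose_mult[of _ m m _ m] assoc_mult_mat[of _ m m _ m _ m])
  then have QQt: "Q * transpose_mat Q = 1\<^sub>m m"
    using U by (simp add: orthogonal_cancel[OF assms(2) U(1)])
  have "transpose_mat Q * Q = transpose_mat U' * (U * (transpose_mat U * U'))"
    using U(1) U'(1) by (simp add: Q_def transpose_mult[of _ m m _ m] assoc_mult_mat[of _ m m _ m _ m])
  then have QtQ: "transpose_mat Q * Q = 1\<^sub>m m"
    using U' by (simp add: orthogonal_cancel[OF assms(1) U'(1)])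
  show "(\<Sum>j<m. (Q $$ (i, j))\<^sup>2) = 1" if "i < m"
  proof -
    have "(\<Sum>j<m. (Q $$ (i, j))\<^sup>2) = (Q * transpose_mat Q) $$ (i, i)"
      using Q that by (simp add: scalar_prod_def atLeast0LessThan power2_eq_square)
    then show ?thesis using that QQt by simp
  qed
  show "(\<Sum>i<m. (Q $$ (i, j))\<^sup>2) = 1" if "j < m"
  proof -
    have "(\<Sum>i<m. (Q $$ (i, j))\<^sup>2) = (transpose_mat Q * Q) $$ (j, j)"
      using Q that by (simp add: scalar_prod_def atLeast0LessThan power2_eq_square)
    then show ?thesis using that QtQ by simp
  qed
qed

text \<open>In the second basis \<open>X X^T\<close> becomes \<open>Q^T diag(z) Q\<close>, with
  \<open>Q\<close> the overlap of the two bases; read off its diagonal.\<close>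

lemma row_energy_diagonalizes:
  assumes "diagonalizes m U z X" "orthogonal_basis m U'" "X \<in> carrier_mat m n" "j < m"
  shows "row_energy U' X j = (\<Sum>i<m. ((transpose_mat U * U') $$ (i, j))\<^sup>2 * z i)"
proof -
  have U: "orthogonal_basis m U" using assms(1) by (simp add: diagonalizes_def)
  note c = orthogonal_basisD(1)[OF U] orthogonal_basisD(1)[OF assms(2)]
  define Y where "Y = transpose_mat U * X"
  define Q where "Q = transpose_mat U * U'"
  have Y: "Y \<in> carrier_mat m n" and Q: "Q \<in> carrier_mat m m" using c assms by (auto simp: Y_def Q_def)
  have X: "transpose_mat U' * X = transpose_mat Q * Y"
    using c assms(3)
    by (simp add: Q_def Y_def transpose_mult[of _ m m _ m] assoc_mult_mat[of _ m m _ m _ n]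
        orthogonal_cancel[OF U])
  have t: "transpose_mat (transpose_mat Q * Y) = transpose_mat Y * Q"
    using Q Y by (simp add: transpose_mult[of _ m m _ n])
  have "transpose_mat Q * Y * transpose_mat (transpose_mat Q * Y)
      = transpose_mat Q * ((Y * transpose_mat Y) * Q)"
    unfolding t using Q Y by (simp add: assoc_mult_mat[of _ m m _ n _ m] assoc_mult_mat[of _ m n _ m _ m])
  also have "\<dots> = transpose_mat Q * (mat_diag m z * Q)"
    using assms(1) by (simp add: diagonalizes_def Y_def)
  finally have *: "transpose_mat Q * Y * transpose_mat (transpose_mat Q * Y) = transpose_mat Q * (mat_diag m z * Q)" .
  have "row_energy U' X j = (transpose_mat Q * Y * transpose_mat (transpose_mat Q * Y)) $$ (j, j)"
    using Q Y assms(3,4) unfolding row_energy_def X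
    by (auto simp: scalar_prod_def atLeast0LessThan power2_eq_square intro!: sum.cong)
  also have "\<dots> = (\<Sum>i<m. (Q $$ (i, j))\<^sup>2 * z i)"
    unfolding * using Q assms(4)
    by (auto simp: mat_diag_mult_left[of _ m m] scalar_prod_def atLeast0LessThan power2_eq_square intro!: sum.cong)
  finally show ?thesis by (simp add: Q_def)
qed

lemma row_energy_diagonalizes_self:
  assumes "diagonalizes m U z X" "X \<in> carrier_mat m n" "i < m"
  shows "row_energy U X i = z i"
proof -
  have U: "orthogonal_basis m U" using assms(1) by (simp add: diagonalizes_def)
  have "row_energy U X i = (\<Sum>k<m. if k = i then z k else 0)"
    unfolding row_energy_diagonalizes[OF assms(1) U assms(2,3)]
    using orthogonal_basisD[OF U] assms(3) by (intro sum.cong) auto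
  then show ?thesis using assms(3) by simp
qed

text \<open>A matrix that is diagonal in the same eigenbasis merely rescales the singular values.
  This gives the spectrum of the penalty gradient.\<close>

lemma diagonalizes_conj_diag:
  assumes "diagonalizes m U z X" "X \<in> carrier_mat m n"
  shows "diagonalizes m U (\<lambda>i. (d i)\<^sup>2 * z i) (conj_diag m U d * X)"
proof -
  have U: "orthogonal_basis m U" using assms(1) by (simp add: diagonalizes_def)
  note c = orthogonal_basisD(1)[OF U]
  define Y where "Y = transpose_mat U * X"
  have Y: "Y \<in> carrier_mat m n" using c assms by (auto simp: Y_def)
  have X: "transpose_mat U * (conj_diag m U d * X) = mat_diag m d * Y"
    using c assms(2) by (simp add: conj_diag_apply[of _ m _ n] Y_def orthogonal_cancel[OF U, of _ n])
  have "(mat_diag m d * Y) * transpose_mat (mat_diag m d * Y)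
      = mat_diag m d * ((Y * transpose_mat Y) * mat_diag m d)"
    using Y by (simp add: transpose_mult[of _ m m _ n] assoc_mult_mat[of _ m m _ n _ m] assoc_mult_mat[of _ m n _ m _ m])
  also have "Y * transpose_mat Y = mat_diag m z"
    using assms(1) by (simp add: diagonalizes_def Y_def)
  finally show ?thesis using U by (simp add: diagonalizes_def X power2_eq_square ac_simps)
qed

text \<open>The right factor cancels in \<open>X X^T\<close>, which leaves \<open>S S^T\<close>, a
  diagonal matrix of squares. Bridge from the oracle's answers to
  \<open>diagonalizes\<close>.\<close>

lemma svd_diagonalizes:
  assumes "is_svd X (U, S, V)" "X \<in> carrier_mat m n"
  defines "z \<equiv> row_energy U X"
  shows "diagonalizes m U z X" "\<And>i j. i \<le> j \<Longrightarrow> j < m \<Longrightarrow> z j \<le> z i"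
proof -
  have dims: "dim_row X = m" "dim_col X = n" using assms(2) by auto
  have U: "orthogonal_basis m U" and V: "orthogonal_basis n V" and S: "S \<in> carrier_mat m n" "diagonal_mat S"
    and S0: "\<forall>i<min m n. 0 \<le> S $$ (i, i)"
    and Sd: "\<forall>i j. i \<le> j \<and> j < min m n \<longrightarrow> S $$ (j, j) \<le> S $$ (i, i)"
    and X: "X = U * S * transpose_mat V"
    using assms(1) unfolding is_svd_def dims orthogonal_basis_def by auto
  note cU = orthogonal_basisD(1)[OF U] and cV = orthogonal_basisD(1)[OF V]
  \<comment> \<open>If \<open>m > n\<close> there are fewer singular values than rows. Padding by
    zeros keeps the sequence nonincreasing.\<close>
  define \<sigma> where "\<sigma> i = (if i < n then S $$ (i, i) else 0)" for i
  have "transpose_mat U * X = transpose_mat U * (U * (S * transpose_mat V))"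
    unfolding X using cU cV S(1) by (simp add: assoc_mult_mat[of _ m m _ n _ n])
  then have UX: "transpose_mat U * X = S * transpose_mat V"
    using orthogonal_cancel[OF U, of "S * transpose_mat V" n] cV S(1) by auto
  have "(S * transpose_mat V) * transpose_mat (S * transpose_mat V)
      = S * (transpose_mat V * (V * transpose_mat S))"
    using S(1) cV by (simp add: transpose_mult[of _ m n _ n] assoc_mult_mat[of _ m n _ n _ m])
  also have "\<dots> = S * transpose_mat S"
    using orthogonal_cancel[OF V, of "transpose_mat S" m] S(1) by simp
  also have "\<dots> = mat_diag m (\<lambda>i. (\<sigma> i)\<^sup>2)"
  proof (rule eq_matI)
    fix i j assume "i < dim_row (mat_diag m (\<lambda>i. (\<sigma> i)\<^sup>2))" "j < dim_col (mat_diag m (\<lambda>i. (\<sigma> i)\<^sup>2))"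
    then have ij: "i < m" "j < m" by (auto simp: mat_diag_def)
    have "(S * transpose_mat S) $$ (i, j) = (\<Sum>k<n. S $$ (i, k) * S $$ (j, k))"
      using S(1) ij by (simp add: scalar_prod_def atLeast0LessThan)
    also have "\<dots> = (\<Sum>k<n. if k = i then (if i = j then (\<sigma> i)\<^sup>2 else 0) else 0)"
      using S ij by (intro sum.cong) (auto simp: \<sigma>_def diagonal_mat_def power2_eq_square)
    also have "\<dots> = mat_diag m (\<lambda>i. (\<sigma> i)\<^sup>2) $$ (i, j)"
      using ij by (auto simp: mat_diag_def \<sigma>_def)
    finally show "(S * transpose_mat S) $$ (i, j) = mat_diag m (\<lambda>i. (\<sigma> i)\<^sup>2) $$ (i, j)" .
  qed (use S in \<open>auto simp: mat_diag_def\<close>)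
  finally have D: "diagonalizes m U (\<lambda>i. (\<sigma> i)\<^sup>2) X" using U UX by (simp add: diagonalizes_def)
  have z: "z i = (\<sigma> i)\<^sup>2" if "i < m" for i
    using row_energy_diagonalizes_self[OF D assms(2) that] by (simp add: z_def)
  have "mat_diag m (\<lambda>i. (\<sigma> i)\<^sup>2) = mat_diag m z" using z by (auto simp: mat_diag_def)
  then show "diagonalizes m U z X" using D by (simp add: diagonalizes_def)
  show "z j \<le> z i" if "i \<le> j" "j < m" for i j
    using that S0 Sd by (auto simp: z \<sigma>_def intro!: power_mono)
qed

section \<open>Matrices of low rank\<close>

text \<open>Rank at most \<open>l\<close>, phrased as a product of inner dimension \<open>l\<close>.
  Entry functions instead of matrices for the two factors make padding and concatenation
  immediate.\<close>

definition factors_through :: "nat \<Rightarrow> nat \<Rightarrow> nat \<Rightarrow> real mat \<Rightarrow> bool" where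
  "factors_through m n l X \<longleftrightarrow> X \<in> carrier_mat m n \<and>
     (\<exists>b c. \<forall>i<m. \<forall>j<n. X $$ (i, j) = (\<Sum>k<l. b i k * c k j))"

lemma factors_through_carrier: "factors_through m n l X \<Longrightarrow> X \<in> carrier_mat m n"
  by (simp add: factors_through_def)

text \<open>Induction on \<open>l\<close>: each summand is an outer product of rank at most 1, and
  rank is subadditive.\<close>

lemma rank_le_of_factors_through:
  assumes "factors_through m n l X"
  shows "vec_space.rank m X \<le> l"
proof -
  interpret vec_space "TYPE(real)" m .
  obtain b c where X: "X \<in> carrier_mat m n" and bc: "\<And>i j. i < m \<Longrightarrow> j < n \<Longrightarrow> X $$ (i, j) = (\<Sum>k<l. b i k * c k j)"
    using assms unfolding factors_through_def by blast
  have *: "rank (mat m n (\<lambda>(i, j). \<Sum>k<l. b i k * c k j)) \<le> l" for l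
  proof (induction l)
    case 0
    have "mat m n (\<lambda>(i, j). \<Sum>k<0. b i k * c k j) = 0\<^sub>m m n" by (rule eq_matI) auto
    then show ?case by (simp only: rank_0I order_refl)
  next
    case (Suc l)
    have "mat m n (\<lambda>(i, j). \<Sum>k<Suc l. b i k * c k j)
      = mat m n (\<lambda>(i, j). \<Sum>k<l. b i k * c k j) + mat m n (\<lambda>(i, j). b i l * c l j)"
      by (rule eq_matI) auto
    then have "rank (mat m n (\<lambda>(i, j). \<Sum>k<Suc l. b i k * c k j))
      \<le> rank (mat m n (\<lambda>(i, j). \<Sum>k<l. b i k * c k j)) + rank (mat m n (\<lambda>(i, j). b i l * c l j))"
      by (simp add: rank_subadditive[of _ n])
    moreover have "rank (mat m n (\<lambda>(i, j). b i l * c l j)) \<le> 1"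
      by (rule rank_le_1_product_entries[of _ n]) auto
    ultimately show ?case using Suc.IH by simp
  qed
  have "X = mat m n (\<lambda>(i, j). \<Sum>k<l. b i k * c k j)" using X bc by (intro eq_matI) auto
  then show ?thesis using *[of l] by metis
qed

lemma factors_through_mono:
  assumes "factors_through m n k X" "k \<le> l"
  shows "factors_through m n l X"
proof -
  obtain b c where X: "X \<in> carrier_mat m n" and bc: "\<forall>i<m. \<forall>j<n. X $$ (i, j) = (\<Sum>k<k. b i k * c k j)"
    using assms unfolding factors_through_def by blast
  have "(\<Sum>q<k. b i q * c q j) = (\<Sum>q<l. (if q < k then b i q else 0) * c q j)" for i j
    using assms(2) by (intro sum.mono_neutral_cong_left) auto
  then show ?thesis using X bc unfolding factors_through_def
    by (intro conjI exI[of _ "\<lambda>i q. if q < k then b i q else 0"] exI[of _ c]) auto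
qed

text \<open>A maximal independent set of columns has as many elements as the rank and spans all
  columns: its vectors form the left factor, the coordinates with respect to them the right
  one.\<close>

lemma factors_through_of_rank_le:
  assumes "X \<in> carrier_mat m n" "vec_space.rank m X \<le> l"
  shows "factors_through m n l X"
proof -
  interpret vec_space "TYPE(real)" m .
  let ?indep = "\<lambda>T. T \<subseteq> set (cols X) \<and> lin_indpt T"
  have sub: "set (cols X) \<subseteq> carrier_vec m" using cols_dim assms(1) by blast
  obtain S where S: "maximal S ?indep"
    using maximal_exists[of ?indep "card (set (cols X))" "{}"]
    by (meson List.finite_set card_mono empty_iff empty_subsetI finite_lin_indpt2 rev_finite_subset)
  have SX: "S \<subseteq> set (cols X)" and indep: "lin_indpt S" using S by (auto simp: maximal_def)
  have Sc: "S \<subseteq> carrier_vec m" and fin: "finite S" using SX sub by (auto intro: finite_subset)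
  have "card S \<le> l" using rank_card_indpt[OF assms(1) S] assms(2) by simp
  \<comment> \<open>A column outside the span could be added to \<open>S\<close> without losing
    independence, against maximality.\<close>
  have in_span: "v \<in> span S" if v: "v \<in> set (cols X)" for v
  proof (rule ccontr)
    assume nin: "v \<notin> span S"
    have "v \<in> carrier_vec m" using v sub by blast
    then have "lin_indpt (insert v S)"
      using lin_dep_iff_in_span[OF Sc indep, of v] nin span_mem[OF Sc] by auto
    then have "insert v S = S" using S SX v by (auto simp: maximal_def)
    then show False using nin span_mem[OF Sc] by auto
  qed
  have "\<exists>a. col X j = lincomb a S" if "j < n" for j
  proof -
    have "col X j \<in> set (cols X)" using that assms(1) by (auto simp: cols_def)
    then show ?thesis using in_span finite_in_span[OF fin] Sc by (metis)
  qed
  then obtain a where a: "\<And>j. j < n \<Longrightarrow> col X j = lincomb (a j) S" by metis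
  obtain h where h: "bij_betw h {..<card S} S"
    using ex_bij_betw_nat_finite[OF fin] by (auto simp: atLeast0LessThan)
  have "X $$ (i, j) = (\<Sum>k<card S. h k $ i * a j (h k))" if "i < m" "j < n" for i j
  proof -
    have "X $$ (i, j) = lincomb (a j) S $ i" using a[OF that(2)] that assms(1) by (metis carrier_matD index_col)
    also have "\<dots> = (\<Sum>x\<in>S. a j x * x $ i)" using lincomb_index[OF that(1) Sc] by simp
    also have "\<dots> = (\<Sum>k<card S. a j (h k) * h k $ i)" by (rule sum.reindex_bij_betw[OF h, symmetric])
    finally show ?thesis by (simp add: mult.commute)
  qed
  then have "factors_through m n (card S) X"
    using assms(1) unfolding factors_through_def
    by (intro conjI exI[of _ "\<lambda>i k. h k $ i"] exI[of _ "\<lambda>k j. a j (h k)"]) auto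
  then show ?thesis using \<open>card S \<le> l\<close> by (rule factors_through_mono)
qed

lemma factors_through_smult:
  assumes "factors_through m n l X"
  shows "factors_through m n l (a \<cdot>\<^sub>m X)"
proof -
  obtain b c where X: "X \<in> carrier_mat m n" and bc: "\<forall>i<m. \<forall>j<n. X $$ (i, j) = (\<Sum>k<l. b i k * c k j)"
    using assms unfolding factors_through_def by blast
  then show ?thesis unfolding factors_through_def
    by (intro conjI exI[of _ "\<lambda>i k. a * b i k"] exI[of _ c]) (auto simp: sum_distrib_left mult.assoc)
qed

text \<open>Put the two left factors side by side and stack the two right factors.\<close>

lemma factors_through_add:
  assumes "factors_through m n k X" "factors_through m n l Y"
  shows "factors_through m n (k + l) (X + Y)"
proof -
  obtain b c where X: "X \<in> carrier_mat m n" and bc: "\<forall>i<m. \<forall>j<n. X $$ (i, j) = (\<Sum>q<k. b i q * c q j)"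
    using assms unfolding factors_through_def by blast
  obtain b' c' where Y: "Y \<in> carrier_mat m n" and bc': "\<forall>i<m. \<forall>j<n. Y $$ (i, j) = (\<Sum>q<l. b' i q * c' q j)"
    using assms unfolding factors_through_def by blast
  have split: "(\<Sum>q<k + l. (if q < k then f q else g (q - k))) = (\<Sum>q<k. f q) + (\<Sum>q<l. g q)"
    for f g :: "nat \<Rightarrow> real"
    by (induction l) auto
  have "(\<Sum>q<k + l. (if q < k then b i q else b' i (q - k)) * (if q < k then c q j else c' (q - k) j))
    = (\<Sum>q<k. b i q * c q j) + (\<Sum>q<l. b' i q * c' q j)" for i j
    unfolding split[symmetric] by (intro sum.cong) auto
  then show ?thesis using X Y bc bc' unfolding factors_through_def
    by (intro conjI exI[of _ "\<lambda>i q. if q < k then b i q else b' i (q - k)"]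
        exI[of _ "\<lambda>q j. if q < k then c q j else c' (q - k) j"]) auto
qed

text \<open>Only the first \<open>l\<close> columns of \<open>U\<close> survive in the product; for
  \<open>l > m\<close> the missing ones are read as zero.\<close>

lemma factors_through_head_proj:
  assumes "U \<in> carrier_mat m m" "X \<in> carrier_mat m n"
  shows "factors_through m n l (head_proj m U l * X)"
proof -
  define Y where "Y = transpose_mat U * X"
  have Y: "Y \<in> carrier_mat m n" using assms by (simp add: Y_def)
  have "(head_proj m U l * X) $$ (i, j) = (\<Sum>k<l. (if k < m then U $$ (i, k) else 0) * Y $$ (k, j))"
    if "i < m" "j < n" for i j
  proof -
    have "(head_proj m U l * X) $$ (i, j) = (\<Sum>k<m. U $$ (i, k) * (of_bool (k < l) * Y $$ (k, j)))"
      using assms that Y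
      by (simp add: conj_diag_apply[of _ m _ n] flip: Y_def)
        (simp add: mat_diag_mult_left[of _ m n] scalar_prod_def atLeast0LessThan)
    also have "\<dots> = (\<Sum>k\<in>{..<m} \<inter> {..<l}. U $$ (i, k) * Y $$ (k, j))"
      by (intro sum.mono_neutral_cong_right) auto
    also have "\<dots> = (\<Sum>k<l. (if k < m then U $$ (i, k) else 0) * Y $$ (k, j))"
      by (intro sum.mono_neutral_cong_left) auto
    finally show ?thesis .
  qed
  then show ?thesis using assms unfolding factors_through_def
    by (intro conjI exI[of _ "\<lambda>i k. if k < m then U $$ (i, k) else 0"] exI[of _ "\<lambda>k j. Y $$ (k, j)"]) auto
qed

text \<open>The left side is what the program computes, the right side what the analysis uses. The
  minimum reflects that \<open>U\<close> has only \<open>m\<close> columns to select.\<close>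

lemma columns_mult_transpose:
  assumes "U \<in> carrier_mat m m" "X \<in> carrier_mat m n" "p = min l m"
  defines "Us \<equiv> mat m p (($$) U)"
  shows "Us * (transpose_mat Us * X) = head_proj m U l * X"
proof (rule eq_matI)
  define Y where "Y = transpose_mat U * X"
  have Y: "Y \<in> carrier_mat m n" using assms by (simp add: Y_def)
  fix i j assume "i < dim_row (head_proj m U l * X)" "j < dim_col (head_proj m U l * X)"
  then have ij: "i < m" "j < n" using assms by (auto simp: conj_diag_def)
  have Us: "(transpose_mat Us * X) $$ (k, j) = Y $$ (k, j)" if "k < p" for k
    using that assms ij by (simp add: Us_def Y_def scalar_prod_def)
  have "(Us * (transpose_mat Us * X)) $$ (i, j) = (\<Sum>k<p. U $$ (i, k) * Y $$ (k, j))"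
    using Us assms(2) ij by (simp add: Us_def scalar_prod_def atLeast0LessThan)
  also have "\<dots> = (\<Sum>k<m. U $$ (i, k) * (of_bool (k < l) * Y $$ (k, j)))"
    using assms(3) by (intro sum.mono_neutral_cong_left) auto
  also have "\<dots> = (head_proj m U l * X) $$ (i, j)"
    using assms(1,2) ij Y
      by (simp add: conj_diag_apply[of _ m _ n] flip: Y_def)
        (simp add: mat_diag_mult_left[of _ m n] scalar_prod_def atLeast0LessThan)
  finally show "(Us * (transpose_mat Us * X)) $$ (i, j) = (head_proj m U l * X) $$ (i, j)" .
qed (use assms in \<open>auto simp: conj_diag_def\<close>)

text \<open>Take a singular value decomposition of the left factor, which has only \<open>l\<close>
  columns: its column space lies in the span of the first \<open>l\<close> left singular vectors.
  The existence of decompositions is a hypothesis here and is later supplied by the oracle.\<close>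

lemma head_proj_fixes_factors_through:
  assumes svd: "\<And>A. \<exists>U S V. is_svd A (U, S, V)" and "factors_through m n l X"
  shows "\<exists>U. orthogonal_basis m U \<and> head_proj m U l * X = X"
proof -
  obtain b c where X: "X \<in> carrier_mat m n" and bc: "\<forall>i<m. \<forall>j<n. X $$ (i, j) = (\<Sum>k<l. b i k * c k j)"
    using assms unfolding factors_through_def by blast
  define B where "B = mat m l (\<lambda>(i, k). b i k)"
  define C where "C = mat l n (\<lambda>(k, j). c k j)"
  have BC: "B \<in> carrier_mat m l" "C \<in> carrier_mat l n" by (auto simp: B_def C_def)
  have XBC: "X = B * C"
    using X bc by (intro eq_matI) (auto simp: B_def C_def scalar_prod_def atLeast0LessThan)
  obtain U S V where "is_svd B (U, S, V)" using svd by blast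
  then have U: "orthogonal_basis m U" and V: "V \<in> carrier_mat l l" and S: "S \<in> carrier_mat m l" "diagonal_mat S"
    and B: "B = U * S * transpose_mat V"
    using BC by (auto simp: is_svd_def orthogonal_basis_def)
  note cU = orthogonal_basisD(1)[OF U]
  \<comment> \<open>\<open>S\<close> is diagonal with \<open>l\<close> columns, so its rows from
    index \<open>l\<close> on are zero.\<close>
  have "mat_diag m (\<lambda>i. of_bool (i < l)) * S = S"
    using S by (subst mat_diag_mult_left[OF S(1)]) (auto simp: diagonal_mat_def intro!: eq_matI)
  moreover have "transpose_mat U * (U * (S * (transpose_mat V * C))) = S * (transpose_mat V * C)"
    using cU V S(1) BC by (intro orthogonal_cancel[OF U, of _ n]) auto
  moreover have "X = U * (S * (transpose_mat V * C))"
    unfolding XBC B using cU V S(1) BC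
    by (simp add: assoc_mult_mat[of _ m m _ l _ l] assoc_mult_mat[of _ m l _ l _ n]
        assoc_mult_mat[of _ m m _ l _ n] mult_carrier_mat[of _ _ l])
  moreover have "mat_diag m (\<lambda>i. of_bool (i < l)) * (S * (transpose_mat V * C))
      = (mat_diag m (\<lambda>i. of_bool (i < l)) * S) * (transpose_mat V * C)"
    using V S(1) BC by (intro assoc_mult_mat[symmetric, of _ m m _ l _ n]) auto
  ultimately have "head_proj m U l * X = X" 
    using cU X by (simp add: conj_diag_apply[of _ m _ n])
  then show ?thesis using U by blast
qed

section \<open>Optimality of spectral truncation\<close>

text \<open>A rearrangement bound: weights in [0, 1] of total mass \<open>m - l\<close> give the
  least value when they sit on the last \<open>m - l\<close> terms of a nonincreasing sequence. For
  \<open>l \<ge> m\<close> the left side is an empty sum, hence the restricted mass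
  hypothesis.\<close>

lemma tail_sum_le_weighted_sum:
  fixes s q :: "nat \<Rightarrow> real"
  assumes mono: "\<And>i j. i \<le> j \<Longrightarrow> j < m \<Longrightarrow> s j \<le> s i" and q: "\<And>i. i < m \<Longrightarrow> 0 \<le> q i \<and> q i \<le> 1"
    and s: "\<And>i. i < m \<Longrightarrow> 0 \<le> s i" and total: "l < m \<Longrightarrow> (\<Sum>i<m. q i) = real m - real l"
  shows "(\<Sum>i<m. of_bool (l \<le> i) * s i) \<le> (\<Sum>i<m. q i * s i)"
proof (cases "l < m")
  case True
  \<comment> \<open>The value \<open>s l\<close> is the pivot: before index \<open>l\<close> the
    factor is nonnegative and \<open>s i\<close> is above the pivot, from \<open>l\<close> on both
    signs flip. Replacing \<open>s i\<close> by the constant pivot makes the sum vanish.\<close>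
  have "(q i - of_bool (l \<le> i)) * s l \<le> (q i - of_bool (l \<le> i)) * s i" if "i < m" for i
  proof (cases "l \<le> i")
    case True
    then show ?thesis using mono[of l i] q[of i] that \<open>l < m\<close> by (intro mult_left_mono_neg) auto
  next
    case False
    then show ?thesis using mono[of i l] q[of i] that \<open>l < m\<close> by (intro mult_left_mono) auto
  qed
  then have "(\<Sum>i<m. (q i - of_bool (l \<le> i)) * s l) \<le> (\<Sum>i<m. (q i - of_bool (l \<le> i)) * s i)"
    by (intro sum_mono) auto
  moreover have "(\<Sum>i<m. of_bool (l \<le> i) :: real) = real m - real l"
  proof -
    have "{..<m} \<inter> {i. l \<le> i} = {l..<m}" by auto
    then show ?thesis using True by (simp add: of_nat_diff)
  qed
  then have "(\<Sum>i<m. (q i - of_bool (l \<le> i)) * s l) = 0"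
    using total[OF True] by (simp add: sum_subtractf flip: sum_distrib_right)
  ultimately show ?thesis by (simp add: left_diff_distrib sum_subtractf)
next
  case False
  then show ?thesis using q s by (auto intro!: sum_nonneg mult_nonneg_nonneg)
qed

text \<open>Eckart--Young: with \<open>Q\<close> the projection onto the column space of \<open>B\<close>, the distance is at
  least that of \<open>A\<close> to \<open>Q A\<close>, a combination of the \<open>z i\<close> with weights in \<open>[0, 1]\<close> of sum \<open>m - l\<close>.\<close>

lemma eckart_young:
  assumes svd: "\<And>A. \<exists>U S V. is_svd A (U, S, V)"
    and A: "diagonalizes m U z A" "A \<in> carrier_mat m n"
    and mono: "\<And>i j. i \<le> j \<Longrightarrow> j < m \<Longrightarrow> z j \<le> z i"
    and B: "factors_through m n l B"
  shows "(\<Sum>i<m. of_bool (l \<le> i) * z i) \<le> frob_inner (A - B) (A - B)"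
proof -
  obtain Q where Q: "orthogonal_basis m Q" and QB: "head_proj m Q l * B = B"
    using head_proj_fixes_factors_through[OF svd B] by blast
  note cQ = orthogonal_basisD(1)[OF Q] and Bc = factors_through_carrier[OF B]
  have U: "orthogonal_basis m U" using A by (simp add: diagonalizes_def)
  have AB: "A - B \<in> carrier_mat m n" using A Bc by (simp add: minus_carrier_mat)
  define O' where "O' = transpose_mat U * Q"
  \<comment> \<open>The squared length of the component of the \<open>i\<close>-th column of
    \<open>U\<close> in the span of the columns of \<open>Q\<close> from index \<open>l\<close>
    on.\<close>
  define q where "q i = (\<Sum>j<m. of_bool (l \<le> j) * (O' $$ (i, j))\<^sup>2)" for i
  note overlap = orthogonal_basis_overlap[OF U Q, folded O'_def]
  have "(\<Sum>i<m. of_bool (l \<le> i) * z i) \<le> (\<Sum>i<m. q i * z i)"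
  proof (rule tail_sum_le_weighted_sum[OF mono])
    show "0 \<le> q i \<and> q i \<le> 1" if "i < m" for i
      unfolding overlap(2)[OF that, symmetric] q_def
      by (auto intro!: sum_nonneg sum_mono simp: of_bool_def)
    show "0 \<le> z i" if "i < m" for i
      using row_energy_diagonalizes_self[OF A that] row_energy_nonneg by metis
    have "(\<Sum>i<m. q i) = (\<Sum>j<m. of_bool (l \<le> j) * (\<Sum>i<m. (O' $$ (i, j))\<^sup>2))"
      unfolding q_def by (subst sum.swap) (simp add: sum_distrib_left)
    also have "\<dots> = (\<Sum>j<m. of_bool (l \<le> j))" by (intro sum.cong) (auto simp: overlap(3))
    also have "\<dots> = real m - real l" if "l < m"
    proof -
      have "{..<m} \<inter> {i. l \<le> i} = {l..<m}" by auto
      then show ?thesis using that by (simp add: of_nat_diff)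
    qed
    finally show "(\<Sum>i<m. q i) = real m - real l" if "l < m" using that by simp
  qed auto
  also have "(\<Sum>i<m. q i * z i) = (\<Sum>j<m. of_bool (l \<le> j) * row_energy Q A j)"
  proof -
    have "(\<Sum>i<m. q i * z i) = (\<Sum>i<m. \<Sum>j<m. of_bool (l \<le> j) * ((O' $$ (i, j))\<^sup>2 * z i))"
      by (simp only: q_def sum_distrib_right mult.assoc)
    also have "\<dots> = (\<Sum>j<m. \<Sum>i<m. of_bool (l \<le> j) * ((O' $$ (i, j))\<^sup>2 * z i))"
      by (rule sum.swap)
    also have "\<dots> = (\<Sum>j<m. of_bool (l \<le> j) * row_energy Q A j)"
      using row_energy_diagonalizes[OF A(1) Q A(2)]
      by (intro sum.cong) (simp_all only: lessThan_iff sum_distrib_left O'_def)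
    finally show ?thesis .
  qed
  also have "\<dots> = frob_inner (tail_proj m Q l * A) (tail_proj m Q l * A)"
    by (simp only: frob_inner_conj_diag_idem[OF Q A(2)] flip: of_bool_conj) simp
  \<comment> \<open>The tail projection annihilates \<open>B\<close>, because \<open>B\<close> is
    fixed by the complementary head projection.\<close>
  also have "tail_proj m Q l * A = tail_proj m Q l * (A - B)"
  proof -
    have "tail_proj m Q l * B = tail_proj m Q l * (head_proj m Q l * B)" by (simp only: QB)
    also have "\<dots> = conj_diag m Q (\<lambda>i. 0) * B"
      unfolding conj_diag_mult_apply[OF Q Bc]
      by (intro arg_cong[of _ _ "\<lambda>d. conj_diag m Q d * B"]) auto
    also have "\<dots> = 0\<^sub>m m n"
    proof -
      have "mat_diag m (\<lambda>i. 0::real) = 0\<^sub>m m m" by (auto simp: mat_diag_def)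
      then show ?thesis using cQ Bc by (simp add: conj_diag_apply[of _ m _ n])
    qed
    finally show ?thesis using A cQ Bc 
      by (simp add: mult_minus_distrib_mat[of _ m m _ n])
        (auto intro!: eq_matI simp: conj_diag_def)
  qed
  also have "frob_inner (tail_proj m Q l * (A - B)) (tail_proj m Q l * (A - B))
      \<le> (\<Sum>j<m. row_energy Q (A - B) j)"
    unfolding frob_inner_conj_diag_idem[OF Q AB]
    by (intro sum_mono) (auto simp: row_energy_nonneg)
  also have "\<dots> = frob_inner (A - B) (A - B)" by (rule sum_row_energy[OF Q AB])
  finally show ?thesis .
qed

section \<open>The adaptive penalty\<close>

text \<open>Truncated subtraction makes the ramp zero up to and including index \<open>r\<close>
  (indices start at 0); full weight is reached at \<open>r + k\<close>.\<close>

definition penalty_weight :: "nat \<Rightarrow> nat \<Rightarrow> nat \<Rightarrow> real" where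
  "penalty_weight r k i = real (min k (i - r)) / real k"

lemma penalty_weight_bounds: "0 \<le> penalty_weight r k i" "penalty_weight r k i \<le> 1"
  by (auto simp: penalty_weight_def divide_le_eq)

lemma conj_diag_add_apply:
  assumes "U \<in> carrier_mat m m" "X \<in> carrier_mat m n"
  shows "conj_diag m U d * X + conj_diag m U e * X = conj_diag m U (\<lambda>i. d i + e i) * X"
proof -
  have Y: "transpose_mat U * X \<in> carrier_mat m n" using assms by simp
  have "mat_diag m d * (transpose_mat U * X) + mat_diag m e * (transpose_mat U * X)
      = mat_diag m (\<lambda>i. d i + e i) * (transpose_mat U * X)"
    unfolding mat_diag_mult_left[OF Y] using Y by (intro eq_matI) (auto simp: distrib_right)
  then show ?thesis using assms
    by (simp add: conj_diag_apply[of _ m _ n] flip: mult_add_distrib_mat[of _ m m _ n])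
qed

lemma minus_eq_of_add_eq:
  fixes X :: "'a :: ab_group_add mat"
  assumes "X \<in> carrier_mat m n" "Y \<in> carrier_mat m n" "X + Y = Z"
  shows "Z - X = Y"
  using assms(1,2) unfolding assms(3)[symmetric] by (intro eq_matI) auto

lemma minus_head_proj:
  assumes "orthogonal_basis m U" "X \<in> carrier_mat m n"
  shows "X - head_proj m U l * X = tail_proj m U l * X"
proof -
  note U = orthogonal_basisD(1)[OF assms(1)]
  have "head_proj m U l * X + tail_proj m U l * X = conj_diag m U (\<lambda>i. 1) * X"
    unfolding conj_diag_add_apply[OF U assms(2)]
    by (intro arg_cong[of _ _ "\<lambda>d. conj_diag m U d * X"]) auto
  then have eq: "head_proj m U l * X + tail_proj m U l * X = X"
    using assms by (simp add: conj_diag_const_1)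
  have c: "head_proj m U l * X \<in> carrier_mat m n" "tail_proj m U l * X \<in> carrier_mat m n"
    using U assms by auto
  show ?thesis by (rule minus_eq_of_add_eq[OF c eq])
qed

text \<open>Together with \<open>eckart_young\<close> this shows that truncation in a singular basis
  is optimal: the right side is then the lower bound given there.\<close>

lemma frob_inner_minus_head_proj:
  assumes "orthogonal_basis m U" "X \<in> carrier_mat m n"
  shows "frob_inner (X - head_proj m U l * X) (X - head_proj m U l * X)
    = (\<Sum>i<m. of_bool (l \<le> i) * row_energy U X i)"
  unfolding minus_head_proj[OF assms] frob_inner_conj_diag_idem[OF assms]
  by (simp only: flip: of_bool_conj) simp

text \<open>Layer-cake form: the numerator counts the thresholds \<open>r + 1, ..., r + k\<close>
  that do not exceed \<open>i\<close>.\<close>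

lemma penalty_weight_sum:
  "penalty_weight r k i = (\<Sum>t<k. of_bool (r + 1 + t \<le> i)) / real k"
proof -
  have "{..<k} \<inter> {t. r + 1 + t \<le> i} = {..<min k (i - r)}" by auto
  then show ?thesis by (simp add: penalty_weight_def)
qed

text \<open>The weights are an average of indicators of tails, and the head projection of the right-hand side
  competes with the optimal one for each tail.\<close>

lemma penalty_le_weighted_row_energy:
  assumes svd: "\<And>A. \<exists>U S V. is_svd A (U, S, V)"
    and A: "diagonalizes m V z A" "A \<in> carrier_mat m n"
    and mono: "\<And>i j. i \<le> j \<Longrightarrow> j < m \<Longrightarrow> z j \<le> z i"
    and U: "orthogonal_basis m U"
  shows "(\<Sum>i<m. penalty_weight r k i * z i) \<le> (\<Sum>i<m. penalty_weight r k i * row_energy U A i)"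
proof -
  have expand: "(\<Sum>i<m. penalty_weight r k i * y i) = (\<Sum>t<k. \<Sum>i<m. of_bool (r + 1 + t \<le> i) * y i) / real k" for y
  proof -
    have "(\<Sum>i<m. penalty_weight r k i * y i)
        = (\<Sum>i<m. \<Sum>t<k. of_bool (r + 1 + t \<le> i) * y i) / real k"
      by (simp only: penalty_weight_sum sum_distrib_right sum_divide_distrib times_divide_eq_left)
    also have "\<dots> = (\<Sum>t<k. \<Sum>i<m. of_bool (r + 1 + t \<le> i) * y i) / real k"
      by (subst sum.swap) (rule refl)
    finally show ?thesis .
  qed
  have "(\<Sum>i<m. of_bool (l \<le> i) * z i) \<le> (\<Sum>i<m. of_bool (l \<le> i) * row_energy U A i)" for l
    using eckart_young[OF svd A mono factors_through_head_proj[OF orthogonal_basisD(1)[OF U] A(2)], of l]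
      frob_inner_minus_head_proj[OF U A(2), of l] by simp
  then have "(\<Sum>t<k. \<Sum>i<m. of_bool (r + 1 + t \<le> i) * z i)
      \<le> (\<Sum>t<k. \<Sum>i<m. of_bool (r + 1 + t \<le> i) * row_energy U A i)"
    by (rule sum_mono)
  then show ?thesis unfolding expand by (rule divide_right_mono) simp
qed

section \<open>Inequalities for the ramp weights\<close>

text \<open>The discrete form of a square being twice the area under a ramp: per index the ramp
  grows by at most one, so its square grows by at most twice its new value.\<close>

lemma min_square_le_sum:
  fixes i k r :: nat
  shows "(min k (i - r))\<^sup>2 \<le> 2 * (\<Sum>j\<le>i. min k (j - r))"
proof (induction i)
  case (Suc i)
  let ?a = "min k (i - r)" and ?b = "min k (Suc i - r)"
  have "b\<^sup>2 \<le> a\<^sup>2 + 2 * b" if "b = a \<or> b = Suc a" for a b :: nat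
    using that by (auto simp: power2_eq_square)
  moreover have "?b = ?a \<or> ?b = Suc ?a" by linarith
  ultimately have "?b\<^sup>2 \<le> ?a\<^sup>2 + 2 * ?b" by blast
  then show ?case using Suc.IH by simp
qed auto

text \<open>Since \<open>z\<close> decreases, \<open>z i\<close> may be replaced by
  \<open>z j\<close> for each earlier \<open>j\<close>. After \<open>min_square_le_sum\<close> the
  squared weight thus turns into a partial sum of the penalty.\<close>

lemma penalty_weight_square_le:
  assumes z: "\<And>i. i < m \<Longrightarrow> 0 \<le> z i" and mono: "\<And>i j. i \<le> j \<Longrightarrow> j < m \<Longrightarrow> z j \<le> z i" and "i < m"
  shows "(penalty_weight r k i)\<^sup>2 * z i \<le> 2 / real k * (\<Sum>i<m. penalty_weight r k i * z i)"
proof (cases "k = 0")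
  case True
  then show ?thesis by (simp add: penalty_weight_def)
next
  case False
  have "real ((min k (i - r))\<^sup>2) \<le> real (2 * (\<Sum>j\<le>i. min k (j - r)))"
    using min_square_le_sum by (rule of_nat_mono)
  then have "(penalty_weight r k i)\<^sup>2 \<le> 2 / real k * (\<Sum>j\<le>i. penalty_weight r k j)"
    using False by (simp add: penalty_weight_def power2_eq_square flip: sum_divide_distrib) (simp add: field_simps)
  then have "(penalty_weight r k i)\<^sup>2 * z i \<le> 2 / real k * (\<Sum>j\<le>i. penalty_weight r k j) * z i"
    using z[OF assms(3)] by (rule mult_right_mono)
  also have "\<dots> = 2 / real k * (\<Sum>j\<le>i. penalty_weight r k j * z i)" by (simp add: sum_distrib_right)
  also have "\<dots> \<le> 2 / real k * (\<Sum>j\<le>i. penalty_weight r k j * z j)"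
    using mono assms(3) by (intro mult_left_mono sum_mono) (auto simp: penalty_weight_bounds)
  also have "\<dots> \<le> 2 / real k * (\<Sum>j<m. penalty_weight r k j * z j)"
    using assms(3) z by (intro mult_left_mono sum_mono2) (auto simp: penalty_weight_bounds)
  finally show ?thesis .
qed

lemma sum_of_bool_mult_const:
  "finite I \<Longrightarrow> (\<Sum>i\<in>I. of_bool (i \<in> S) * c) = real (card (I \<inter> S)) * c"
  by (simp flip: sum_distrib_right)

text \<open>Compare both sides with \<open>z (s - r)\<close>: the tail has at most \<open>r\<close>
  nonzero terms, none larger, whereas the indices from \<open>r + k\<close> to
  \<open>s - r - 1\<close> carry full weight and terms at least as large.\<close>

lemma tail_le_penalty:
  assumes z: "\<And>i. i < m \<Longrightarrow> 0 \<le> z i" and mono: "\<And>i j. i \<le> j \<Longrightarrow> j < m \<Longrightarrow> z j \<le> z i"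
    and zero: "\<And>i. i < m \<Longrightarrow> s \<le> i \<Longrightarrow> z i = 0" and k: "k > 0" and s: "2 * r + k \<le> s"
  shows "real (s - 2 * r - k) * (\<Sum>i<m. of_bool (s - r \<le> i) * z i)
    \<le> real r * (\<Sum>i<m. penalty_weight r k i * z i)"
proof (cases "s - r < m")
  case True
  let ?z = "z (s - r)"
  have "(\<Sum>i<m. of_bool (s - r \<le> i) * z i) \<le> (\<Sum>i<m. of_bool (i \<in> {s - r..<s}) * ?z)"
    using mono zero by (intro sum_mono) (auto simp: of_bool_def)
  also have "\<dots> = real (card ({..<m} \<inter> {s - r..<s})) * ?z"
    by (rule sum_of_bool_mult_const) simp
  also have "\<dots> \<le> real r * ?z"
    using z[OF True] s card_mono[of "{s - r..<s}" "{..<m} \<inter> {s - r..<s}"]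
    by (intro mult_right_mono) auto
  finally have 1: "(\<Sum>i<m. of_bool (s - r \<le> i) * z i) \<le> real r * ?z" .
  have one: "penalty_weight r k i = 1" if "r + k \<le> i" for i
    using that k by (simp add: penalty_weight_def min_absorb1)
  have "real (s - 2 * r - k) * ?z = (\<Sum>i\<in>{r + k..<s - r}. ?z)" using s by (simp add: diff_right_commute)
  also have "\<dots> \<le> (\<Sum>i\<in>{r + k..<s - r}. penalty_weight r k i * z i)"
    using mono True by (intro sum_mono) (auto simp: one)
  also have "\<dots> \<le> (\<Sum>i<m. penalty_weight r k i * z i)"
    using True z by (intro sum_mono2) (auto simp: penalty_weight_bounds)
  finally have 2: "real (s - 2 * r - k) * ?z \<le> (\<Sum>i<m. penalty_weight r k i * z i)" .
  have "real (s - 2 * r - k) * (\<Sum>i<m. of_bool (s - r \<le> i) * z i) \<le> real (s - 2 * r - k) * (real r * ?z)"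
    using 1 by (intro mult_left_mono) auto
  also have "\<dots> = real r * (real (s - 2 * r - k) * ?z)" by simp
  also have "\<dots> \<le> real r * (\<Sum>i<m. penalty_weight r k i * z i)" using 2 by (intro mult_left_mono) auto
  finally show ?thesis .
next
  case False
  then have "(\<Sum>i<m. of_bool (s - r \<le> i) * z i) = 0" by (intro sum.neutral) auto
  then show ?thesis using z by (auto simp: penalty_weight_bounds intro!: mult_nonneg_nonneg sum_nonneg)
qed

text \<open>The penalty gradient \<open>W A\<close> is orthogonal to the rank-\<open>r\<close>
  truncation of \<open>A\<close>, so \<open>B\<close> may be replaced by its difference from that
  truncation, of rank at most \<open>2 r\<close>. Only the projection of \<open>W A\<close> to
  \<open>2 r\<close> directions counts, and each direction carries little energy. Young's inequality
  with weight \<open>c\<close> finishes.\<close>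

lemma penalty_gradient_inner_le:
  assumes svd: "\<And>A. \<exists>U S V. is_svd A (U, S, V)"
    and A: "diagonalizes m U z A" "A \<in> carrier_mat m n"
    and mono: "\<And>i j. i \<le> j \<Longrightarrow> j < m \<Longrightarrow> z j \<le> z i"
    and B: "factors_through m n r B" and c: "c > 0"
  shows "frob_inner (conj_diag m U (penalty_weight r k) * A) B
    \<le> c * (2 * real r / real k) * (\<Sum>i<m. penalty_weight r k i * z i)
      + 2 * frob_inner (B - A) (B - A) / c"
proof -
  define \<omega> where "\<omega> = penalty_weight r k"
  define \<Phi> where "\<Phi> = (\<Sum>i<m. \<omega> i * z i)"
  have U: "orthogonal_basis m U" using A(1) by (simp add: diagonalizes_def)
  note cU = orthogonal_basisD(1)[OF U] and Bc = factors_through_carrier[OF B]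
  define WA where "WA = conj_diag m U \<omega> * A"
  define Ar where "Ar = head_proj m U r * A"
  define H where "H = B - Ar"
  have Ar: "Ar \<in> carrier_mat m n" "factors_through m n r Ar"
    using cU A(2) factors_through_head_proj by (auto simp: Ar_def)
  have WA: "WA \<in> carrier_mat m n" and H: "H \<in> carrier_mat m n"
    using cU A(2) Ar Bc by (auto simp: WA_def H_def minus_carrier_mat)
  have z: "0 \<le> z i" if "i < m" for i
    using row_energy_diagonalizes_self[OF A that] row_energy_nonneg by metis
  have \<Phi>0: "0 \<le> \<Phi>" unfolding \<Phi>_def \<omega>_def using z
    by (intro sum_nonneg mult_nonneg_nonneg) (auto simp: penalty_weight_bounds)
  have "frob_inner WA Ar = (\<Sum>i<m. \<omega> i * of_bool (i < r) * row_energy U A i)"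
    unfolding WA_def Ar_def by (rule frob_inner_conj_diag_idem[OF U A(2)])
  also have "\<dots> = 0" by (intro sum.neutral) (auto simp: \<omega>_def penalty_weight_def)
  finally have WAB: "frob_inner WA B = frob_inner WA H"
    using WA Ar Bc by (simp add: H_def frob_inner_linear[of _ m n])
  have "H = B + (-1) \<cdot>\<^sub>m Ar" using Ar Bc by (intro eq_matI) (auto simp: H_def)
  then have "factors_through m n (r + r) H"
    using factors_through_add[OF B factors_through_smult[OF Ar(2)]] by simp
  then obtain Q where Q: "orthogonal_basis m Q" and QH: "head_proj m Q (r + r) * H = H"
    using head_proj_fixes_factors_through[OF svd] by blast
  note cQ = orthogonal_basisD(1)[OF Q]
  define O' where "O' = transpose_mat U * Q"
  note overlap = orthogonal_basis_overlap[OF U Q, folded O'_def]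
  let ?P = "head_proj m Q (r + r)"
  have "frob_inner (?P * WA) (?P * WA) = (\<Sum>j<m. of_bool (j < r + r) * row_energy Q WA j)"
    by (simp only: frob_inner_conj_diag_idem[OF Q WA] flip: of_bool_conj) simp
  also have "\<dots> \<le> (\<Sum>j<m. of_bool (j < r + r) * (2 / real k * \<Phi>))"
  proof (intro sum_mono mult_left_mono)
    fix j assume "j \<in> {..<m}"
    then have j: "j < m" by simp
    \<comment> \<open>An average of the squared singular values of \<open>W A\<close>, because the
      squared overlaps in a column add up to 1; hence it is bounded by their maximum.\<close>
    have "row_energy Q WA j = (\<Sum>i<m. (O' $$ (i, j))\<^sup>2 * ((\<omega> i)\<^sup>2 * z i))"
      using row_energy_diagonalizes[OF diagonalizes_conj_diag[OF A] Q _ j] WA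
      by (simp add: WA_def O'_def)
    also have "\<dots> \<le> (\<Sum>i<m. (O' $$ (i, j))\<^sup>2 * (2 / real k * \<Phi>))"
      using penalty_weight_square_le[OF z mono] unfolding \<omega>_def \<Phi>_def
      by (intro sum_mono mult_left_mono) auto
    also have "\<dots> = 2 / real k * \<Phi>" by (simp only: overlap(3)[OF j] flip: sum_distrib_right)
    finally show "row_energy Q WA j \<le> 2 / real k * \<Phi>" .
  qed auto
  also have "\<dots> = real (card ({..<m} \<inter> {..<r + r})) * (2 / real k * \<Phi>)"
    using sum_of_bool_mult_const[of "{..<m}" "{..<r + r}" "2 / real k * \<Phi>"]
    by (simp only: lessThan_iff finite_lessThan simp_thms)
  also have "\<dots> \<le> real (r + r) * (2 / real k * \<Phi>)"
    using \<Phi>0 card_mono[of "{..<r + r}" "{..<m} \<inter> {..<r + r}"]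
    by (intro mult_right_mono) auto
  finally have PWA: "frob_inner (?P * WA) (?P * WA) \<le> real (r + r) * (2 / real k * \<Phi>)" .
  \<comment> \<open>The truncation \<open>Ar\<close> is at least as close to \<open>A\<close> as
    \<open>B\<close> is, so going from \<open>B\<close> to \<open>Ar\<close> through
    \<open>A\<close> costs at most a factor 4 in squared norm.\<close>
  have "frob_inner (A - Ar) (A - Ar) \<le> frob_inner (A - B) (A - B)"
    using eckart_young[OF svd A mono B] frob_inner_minus_head_proj[OF U A(2), of r]
    by (simp add: Ar_def row_energy_diagonalizes_self[OF A])
  moreover have "H = (B - A) + (A - Ar)" using Ar A(2) Bc by (intro eq_matI) (auto simp: H_def)
  moreover have "frob_inner (A - B) (A - B) = frob_inner (B - A) (B - A)"
    using A(2) Bc frob_inner_commute[OF A(2) Bc] by (simp add: frob_inner_linear[of _ m n] minus_carrier_mat)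
  ultimately have HH: "frob_inner H H \<le> 4 * frob_inner (B - A) (B - A)"
    using frob_inner_add_le[of "B - A" m n "A - Ar"] Ar A(2) Bc by (simp add: minus_carrier_mat)
  have "frob_inner WA H = frob_inner (?P * WA) H"
    using frob_inner_adjoint[of ?P m m WA n H] cQ WA H QH by simp
  then have "2 * frob_inner WA B \<le> c * frob_inner (?P * WA) (?P * WA) + frob_inner H H / c"
    using young_frob_inner[of "?P * WA" m n H c] cQ WA H c by (simp add: WAB)
  also have "\<dots> \<le> c * (real (r + r) * (2 / real k * \<Phi>)) + 4 * frob_inner (B - A) (B - A) / c"
    using PWA HH c by (intro add_mono mult_left_mono divide_right_mono) auto
  also have "\<dots> = 2 * (c * (2 * real r / real k) * \<Phi> + 2 * frob_inner (B - A) (B - A) / c)"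
    by simp
  finally have "frob_inner WA B \<le> c * (2 * real r / real k) * \<Phi> + 2 * frob_inner (B - A) (B - A) / c"
    by (rule mult_left_le_imp_le) simp
  then show ?thesis by (simp only: WA_def \<omega>_def \<Phi>_def)
qed

section \<open>Descent of the penalized objective\<close>

lemma frob_inner_minus_swap:
  assumes "A \<in> carrier_mat m n" "B \<in> carrier_mat m n"
  shows "frob_inner (A - B) (A - B) = frob_inner (B - A) (B - A)"
  using assms frob_inner_commute[OF assms]
  by (simp add: frob_inner_linear[of _ m n] minus_carrier_mat)

lemma frob_inner_self_eq_0:
  assumes "A \<in> carrier_mat m n" "frob_inner A A = 0"
  shows "A = 0\<^sub>m m n"
proof (rule eq_matI)
  fix i j assume "i < dim_row (0\<^sub>m m n)" "j < dim_col (0\<^sub>m m n)"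
  then have ij: "i < m" "j < n" by auto
  have "(\<Sum>i<m. \<Sum>j<n. (A $$ (i, j))\<^sup>2) = 0"
    using assms by (simp add: frob_inner_entries[of _ m n] power2_eq_square)
  then have "(\<Sum>j<n. (A $$ (i, j))\<^sup>2) = 0"
    using ij by (subst (asm) sum_nonneg_eq_0_iff) (auto intro: sum_nonneg)
  then have "(A $$ (i, j))\<^sup>2 = 0" using ij by (subst (asm) sum_nonneg_eq_0_iff) auto
  then show "A $$ (i, j) = 0\<^sub>m m n $$ (i, j)" using ij by simp
qed (use assms in auto)

lemma smooth_funD:
  assumes "smooth_fun m n f f' \<beta>" "A \<in> carrier_mat m n" "B \<in> carrier_mat m n"
  shows "f B \<le> f A + frob_inner (f' A) (B - A) + (\<beta> / 2) * frob_inner (B - A) (B - A)"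
  using assms(1)[unfolded smooth_fun_def, rule_format, OF assms(2,3)]
    frob_norm_power2[OF minus_carrier_mat[OF assms(2), of B]] by simp

lemma strongly_convex_funD:
  assumes "strongly_convex_fun m n f f' \<alpha>" "A \<in> carrier_mat m n" "B \<in> carrier_mat m n"
  shows "f A + frob_inner (f' A) (B - A) + (\<alpha> / 2) * frob_inner (B - A) (B - A) \<le> f B"
  using assms(1)[unfolded strongly_convex_fun_def, rule_format, OF assms(2,3)]
    frob_norm_power2[OF minus_carrier_mat[OF assms(2), of B]] by simp

text \<open>Compare both quadratic bounds at the zero matrix and at the all-ones matrix: the linear
  terms agree, and the squared distance \<open>m n\<close> is positive.\<close>

lemma smoothness_ge_strong_convexity:
  assumes "m \<ge> 1" "n \<ge> 1" "smooth_fun m n f f' \<beta>" "strongly_convex_fun m n f f' \<alpha>"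
  shows "\<alpha> \<le> \<beta>"
proof -
  let ?O = "0\<^sub>m m n :: real mat" and ?J = "mat m n (\<lambda>_. 1) :: real mat"
  have JO: "?J - ?O = ?J" by (rule eq_matI) auto
  have "(\<alpha> / 2) * (frob_norm (?J - ?O))\<^sup>2 \<le> (\<beta> / 2) * (frob_norm (?J - ?O))\<^sup>2"
  proof -
    have "f ?J \<le> f ?O + frob_inner (f' ?O) (?J - ?O) + (\<beta> / 2) * (frob_norm (?J - ?O))\<^sup>2"
      using assms(3) unfolding smooth_fun_def by auto
    moreover have "f ?J \<ge> f ?O + frob_inner (f' ?O) (?J - ?O) + (\<alpha> / 2) * (frob_norm (?J - ?O))\<^sup>2"
      using assms(4) unfolding strongly_convex_fun_def by auto
    ultimately show ?thesis by simp
  qed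
  moreover have "(frob_norm (?J - ?O))\<^sup>2 = real m * real n"
    unfolding JO by (simp add: frob_norm_power2[of _ m n] frob_inner_entries[of _ m n])
  ultimately show ?thesis using assms(1,2) by simp
qed

text \<open>The basis is a parameter: frozen at the basis of the current iterate, the penalty is a
  quadratic form; at a singular basis of \<open>X\<close> itself it is the genuine spectral
  penalty.\<close>

definition penalized :: "nat \<Rightarrow> (real mat \<Rightarrow> real) \<Rightarrow> real \<Rightarrow> (nat \<Rightarrow> real) \<Rightarrow> real mat \<Rightarrow> real mat \<Rightarrow> real" where
  "penalized m f \<beta> \<omega> U X = f X + (\<beta> / 2) * (\<Sum>i<m. \<omega> i * row_energy U X i)"

lemma penalized_smooth:
  assumes smooth: "smooth_fun m n f f' \<beta>" and \<beta>: "\<beta> \<ge> 0"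
    and G: "f' A \<in> carrier_mat m n" and U: "orthogonal_basis m U" and \<omega>: "\<And>i. \<omega> i \<le> 1"
    and AX: "A \<in> carrier_mat m n" "X \<in> carrier_mat m n"
  shows "penalized m f \<beta> \<omega> U X \<le> penalized m f \<beta> \<omega> U A
    + frob_inner (f' A + \<beta> \<cdot>\<^sub>m (conj_diag m U \<omega> * A)) (X - A) + \<beta> * frob_inner (X - A) (X - A)"
proof -
  note cU = orthogonal_basisD(1)[OF U]
  define W where "W = conj_diag m U \<omega>"
  define D where "D = X - A"
  have W: "W \<in> carrier_mat m m" and D: "D \<in> carrier_mat m n"
    using cU AX by (auto simp: W_def D_def minus_carrier_mat)
  have XAD: "X = A + D" using AX by (intro eq_matI) (auto simp: D_def)
  have pen: "penalized m f \<beta> \<omega> U Y = f Y + (\<beta> / 2) * frob_inner (W * Y) Y" if "Y \<in> carrier_mat m n" for Y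
    using that by (simp add: penalized_def W_def frob_inner_conj_diag[OF cU])
  have WDA: "frob_inner (W * D) A = frob_inner (W * A) D"
  proof -
    have "frob_inner (W * D) A = frob_inner D (W * A)"
      using frob_inner_adjoint[OF W D AX(1)] cU by (simp add: W_def)
    also have "\<dots> = frob_inner (W * A) D" using W D AX by (intro frob_inner_commute) auto
    finally show ?thesis .
  qed
  have "frob_inner (W * D) D \<le> frob_inner D D"
    unfolding W_def frob_inner_conj_diag[OF cU D] sum_row_energy[OF U D, symmetric]
    using mult_right_mono[OF \<omega> row_energy_nonneg] by (intro sum_mono) simp
  then have "\<beta> / 2 * frob_inner (W * D) D \<le> \<beta> / 2 * frob_inner D D" using \<beta> by (intro mult_left_mono) auto
  moreover have "frob_inner (W * X) X = frob_inner (W * A) A + 2 * frob_inner (W * A) D + frob_inner (W * D) D"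
    unfolding XAD using W D AX WDA
    by (simp add: mult_add_distrib_mat[of _ m m _ n] frob_inner_linear[of _ m n])
  moreover have "f X \<le> f A + frob_inner (f' A) D + (\<beta> / 2) * frob_inner D D"
    unfolding D_def by (rule smooth_funD[OF smooth AX])
  moreover have "frob_inner (f' A + \<beta> \<cdot>\<^sub>m (W * A)) D = frob_inner (f' A) D + \<beta> * frob_inner (W * A) D"
    using G W D AX by (simp add: frob_inner_linear[of _ m n])
  ultimately show ?thesis
    unfolding pen[OF AX(1)] pen[OF AX(2)] W_def[symmetric] D_def[symmetric]
    by (simp add: algebra_simps)
qed

text \<open>The step is compared with two feasible points: a gradient step inside the column space of \<open>A\<close>,
  which suffices if the projected gradient is large, and otherwise a step towards \<open>Astar\<close>, for which
  the smallest \<open>r\<close> singular values of \<open>A\<close> are given up.\<close>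

lemma penalized_descent:
  fixes K r :: nat and \<alpha> \<beta> :: real
  defines "\<kappa> \<equiv> \<beta> / \<alpha>" and "k \<equiv> 32 * (K * r)" and "s \<equiv> 2 * r + 160 * (K * r)"
  defines "\<omega> \<equiv> penalty_weight r k"
  assumes svd: "\<And>A. \<exists>U S V. is_svd A (U, S, V)"
    and f: "smooth_fun m n f f' \<beta>" "strongly_convex_fun m n f f' \<alpha>" "f' A \<in> carrier_mat m n"
    and \<alpha>: "\<alpha> > 0" "\<alpha> \<le> \<beta>" and K: "\<kappa> \<le> real K" and r: "r \<ge> 1"
    and Astar: "factors_through m n r Astar"
    and A: "factors_through m n s A" "diagonalizes m U z A" "\<And>i j. i \<le> j \<Longrightarrow> j < m \<Longrightarrow> z j \<le> z i"
    and less: "f Astar \<le> f A"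
    and Z: "Z = A - (1 / (2 * \<beta>)) \<cdot>\<^sub>m (f' A + \<beta> \<cdot>\<^sub>m (conj_diag m U \<omega> * A))"
      "diagonalizes m V y Z" "\<And>i j. i \<le> j \<Longrightarrow> j < m \<Longrightarrow> y j \<le> y i"
    and A': "A' = head_proj m V s * Z" "diagonalizes m U' z' A'" "\<And>i j. i \<le> j \<Longrightarrow> j < m \<Longrightarrow> z' j \<le> z' i"
  shows "penalized m f \<beta> \<omega> U' A' - f Astar \<le> (1 - 1 / (64 * \<kappa>)) * (penalized m f \<beta> \<omega> U A - f Astar)"
proof -
  have \<beta>: "\<beta> > 0" using \<alpha> by simp
  have \<kappa>1: "1 \<le> \<kappa>" using \<alpha> by (simp add: \<kappa>_def)
  have K0: "K > 0" using \<kappa>1 K by (cases K) auto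
  have U: "orthogonal_basis m U" and V: "orthogonal_basis m V" and U': "orthogonal_basis m U'"
    using A Z A' by (auto simp: diagonalizes_def)
  note cU = orthogonal_basisD(1)[OF U] and cV = orthogonal_basisD(1)[OF V]
  note Ac = factors_through_carrier[OF A(1)] and As = factors_through_carrier[OF Astar]
  define G where "G = f' A + \<beta> \<cdot>\<^sub>m (conj_diag m U \<omega> * A)"
  define WA where "WA = conj_diag m U \<omega> * A"
  have WA: "WA \<in> carrier_mat m n" using cU Ac by (simp add: WA_def)
  have G: "G \<in> carrier_mat m n" using f cU Ac by (simp add: G_def)
  have Zc: "Z \<in> carrier_mat m n" using Z(1) G Ac by (simp add: minus_carrier_mat flip: G_def)
  have A'c: "A' \<in> carrier_mat m n" using A'(1) cV Zc by simp
  define h where "h = penalized m f \<beta> \<omega> U A"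
  define q where "q X = h + frob_inner G (X - A) + \<beta> * frob_inner (X - A) (X - A)" for X
  have z: "row_energy U A i = z i" if "i < m" for i using row_energy_diagonalizes_self[OF A(2) Ac that] .
  have z0: "0 \<le> z i" if "i < m" for i using z[OF that] row_energy_nonneg by metis
  define \<Phi> where "\<Phi> = (\<Sum>i<m. \<omega> i * z i)"
  have \<Phi>0: "0 \<le> \<Phi>" unfolding \<Phi>_def \<omega>_def using z0
    by (intro sum_nonneg mult_nonneg_nonneg) (auto simp: penalty_weight_bounds)
  have h: "h = f A + (\<beta> / 2) * \<Phi>" by (simp add: h_def penalized_def \<Phi>_def z)
  define \<Delta> where "\<Delta> = h - f Astar"
  have "0 \<le> \<beta> * \<Phi>" using \<Phi>0 \<beta> by simp
  then have \<Delta>0: "0 \<le> \<Delta>" and \<Phi>\<Delta>: "\<beta> * \<Phi> \<le> 2 * \<Delta>" using less by (auto simp: \<Delta>_def h)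

  \<comment> \<open>Completing the square: the model is minimal at \<open>Z\<close>, so truncating
    \<open>Z\<close> minimizes it among matrices of rank at most \<open>s\<close>.\<close>
  have q_Z: "q X = h - frob_inner G G / (4 * \<beta>) + \<beta> * frob_inner (X - Z) (X - Z)"
    if X: "X \<in> carrier_mat m n" for X
  proof -
    define D where "D = X - A"
    have D: "D \<in> carrier_mat m n" using X Ac by (auto simp: D_def minus_carrier_mat)
    have "X - Z = D + (1 / (2 * \<beta>)) \<cdot>\<^sub>m G"
      using X Ac G by (intro eq_matI) (auto simp: D_def Z(1) simp flip: G_def)
    then show ?thesis using D G \<beta> frob_inner_commute[OF D G]
      by (simp add: q_def frob_inner_linear[of _ m n] flip: D_def) (simp add: field_simps power2_eq_square)
  qed
  have best: "penalized m f \<beta> \<omega> U' A' \<le> q X" if X: "factors_through m n s X" for X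
  proof -
    note Xc = factors_through_carrier[OF X]
    have "penalized m f \<beta> \<omega> U' A' = f A' + (\<beta> / 2) * (\<Sum>i<m. \<omega> i * z' i)"
      by (simp add: penalized_def row_energy_diagonalizes_self[OF A'(2) A'c])
    also have "\<dots> \<le> penalized m f \<beta> \<omega> U A'"
      using penalty_le_weighted_row_energy[OF svd A'(2) A'c A'(3) U, of r k] \<beta>
      by (simp add: penalized_def \<omega>_def)
    also have "\<dots> \<le> q A'"
      using penalized_smooth[OF f(1) _ f(3) U _ Ac A'c, of \<omega>] \<beta>
      by (simp add: q_def h_def G_def \<omega>_def penalty_weight_bounds)
    also have "\<dots> \<le> q X"
    proof -
      have "frob_inner (Z - A') (Z - A') \<le> frob_inner (Z - X) (Z - X)"
        using eckart_young[OF svd Z(2) Zc Z(3) X] frob_inner_minus_head_proj[OF V Zc, of s]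
        by (simp add: A'(1) row_energy_diagonalizes_self[OF Z(2) Zc])
      then show ?thesis using \<beta>
        by (simp add: q_Z A'c Xc frob_inner_minus_swap[OF _ Zc])
    qed
    finally show ?thesis .
  qed

  let ?P = "head_proj m U s"
  \<comment> \<open>\<open>A\<close> competes against itself in \<open>eckart_young\<close>, which
    forces all singular values from index \<open>s\<close> on to vanish.\<close>
  have "(\<Sum>i<m. of_bool (s \<le> i) * z i) \<le> frob_inner (A - A) (A - A)"
    by (rule eckart_young[OF svd A(2) Ac A(3) A(1)])
  also have "frob_inner (A - A) (A - A) = 0"
    using Ac by (simp add: frob_inner_entries[of _ m n])
  finally have tail: "(\<Sum>i<m. of_bool (s \<le> i) * z i) \<le> 0" .
  have tail_nonneg: "\<forall>i\<in>{..<m}. 0 \<le> of_bool (s \<le> i) * z i" using z0 by simp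
  then have "0 \<le> (\<Sum>i<m. of_bool (s \<le> i) * z i)" by (intro sum_nonneg) blast
  then have tail0: "(\<Sum>i<m. of_bool (s \<le> i) * z i) = 0" using tail by linarith
  have zero: "z i = 0" if "i < m" "s \<le> i" for i
  proof -
    have "of_bool (s \<le> i) * z i \<le> (\<Sum>i<m. of_bool (s \<le> i) * z i)"
      using that tail_nonneg by (intro member_le_sum) blast+
    then show ?thesis using that z0[of i] tail0 by (simp del: sum_of_bool_mult_eq sum_mult_of_bool_eq)
  qed
  have PA: "?P * A = A"
  proof -
    have "A - ?P * A = 0\<^sub>m m n"
      using frob_inner_minus_head_proj[OF U Ac, of s] tail0 z cU Ac
      by (intro frob_inner_self_eq_0) (auto simp: minus_carrier_mat)
    then have "(A - ?P * A) $$ (i, j) = 0" if "i < m" "j < n" for i j using that by simp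
    then show ?thesis using cU Ac
      by (intro eq_matI) (auto simp: carrier_matD[OF conj_diag_carrier])
  qed
  define PG where "PG = ?P * G"
  have PG: "PG \<in> carrier_mat m n" using cU G by (simp add: PG_def)
  have GPX: "frob_inner G (?P * X) = frob_inner PG X" if "X \<in> carrier_mat m n" for X
    using frob_inner_adjoint[of ?P m m G n X] cU G that by (simp add: PG_def)

  consider "\<Delta> / (64 * \<kappa>) \<le> frob_inner PG PG / (4 * \<beta>)" | "frob_inner PG PG / (4 * \<beta>) < \<Delta> / (64 * \<kappa>)"
    by linarith
  then have "\<exists>X. factors_through m n s X \<and> q X \<le> h - \<Delta> / (64 * \<kappa>)"
  proof cases
    case 1
    \<comment> \<open>The minimizer of the model over the range of the projection; the rank does not
      grow beyond \<open>s\<close>.\<close>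
    define X where "X = A + (- 1 / (2 * \<beta>)) \<cdot>\<^sub>m PG"
    have "X = ?P * (A + (- 1 / (2 * \<beta>)) \<cdot>\<^sub>m G)"
      using cU Ac G
      by (simp add: X_def PG_def PA mult_add_distrib_mat[of _ m m _ n] mult_smult_distrib[of _ m m _ n])
    then have X: "factors_through m n s X"
      using factors_through_head_proj[OF cU] Ac G by simp
    have PPG: "?P * PG = PG" unfolding PG_def conj_diag_mult_apply[OF U G] by (simp flip: of_bool_conj)
    have "X - A = (- 1 / (2 * \<beta>)) \<cdot>\<^sub>m PG" using Ac PG by (intro eq_matI) (auto simp: X_def)
    then have "q X = h - frob_inner G PG / (2 * \<beta>) + frob_inner PG PG / (4 * \<beta>)"
      using G PG \<beta> by (simp add: q_def frob_inner_linear[of _ m n])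
    also have "frob_inner G PG = frob_inner PG PG" using GPX[OF PG] by (simp add: PPG)
    finally have "q X = h - frob_inner PG PG / (4 * \<beta>)" by (simp add: field_simps)
    then show ?thesis using 1 X by (intro exI[of _ X]) simp
  next
    case 2
    \<comment> \<open>The step length is chosen so that the quadratic cost
      \<open>2 \<beta> \<theta>\<^sup>2\<close> per unit of squared distance to \<open>Astar\<close>
      equals the curvature gain \<open>\<theta> \<alpha> / 4\<close> from \<open>GH\<close>.\<close>
    define \<theta> where "\<theta> = 1 / (8 * \<kappa>)"
    have \<theta>: "0 \<le> \<theta>" "\<theta> \<le> 1" using \<kappa>1 by (auto simp: \<theta>_def)
    \<comment> \<open>Adding \<open>T\<close> deletes the singular components from index
      \<open>s - r\<close> on, which leaves room for the rank of \<open>Astar\<close>.\<close>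
    define T where "T = conj_diag m U (\<lambda>i. - of_bool (s - r \<le> i)) * A"
    have T: "T \<in> carrier_mat m n" using cU Ac by (simp add: T_def)
    have AT: "A + T = head_proj m U (s - r) * A"
    proof -
      have "A + T = conj_diag m U (\<lambda>_. 1) * A + T" using Ac by (simp add: conj_diag_const_1[OF U])
      also have "\<dots> = conj_diag m U (\<lambda>i. 1 + - of_bool (s - r \<le> i)) * A"
        unfolding T_def by (rule conj_diag_add_apply[OF cU Ac])
      also have "(\<lambda>i. 1 + - of_bool (s - r \<le> i)) = (\<lambda>i. of_bool (i < s - r) :: real)" by auto
      finally show ?thesis .
    qed
    have PT: "?P * T = T"
    proof -
      have "?P * T = conj_diag m U (\<lambda>i. - of_bool (s - r \<le> i)) * (?P * A)"
        unfolding T_def conj_diag_mult_apply[OF U Ac] by (simp add: mult.commute)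
      then show ?thesis by (simp add: PA T_def)
    qed
    \<comment> \<open>The factor 128 comes from \<open>s - 2 * r - k = 128 * (K * r)\<close>, the
      number of full-weight singular values used by \<open>tail_le_penalty\<close>.\<close>
    have TT: "128 * \<kappa> * frob_inner T T \<le> \<Phi>"
    proof -
      have T2: "frob_inner T T = (\<Sum>i<m. of_bool (s - r \<le> i) * z i)"
        unfolding T_def frob_inner_conj_diag_idem[OF U Ac] by (intro sum.cong) (auto simp: z)
      have "2 * r + k \<le> s" "k > 0" "s - 2 * r - k = 128 * (K * r)"
        using r K0 by (auto simp: s_def k_def)
      then have "real (128 * (K * r)) * frob_inner T T \<le> real r * \<Phi>"
        using tail_le_penalty[where m=m and z=z and s=s and k=k and r=r, OF z0 A(3) zero] unfolding T2 \<Phi>_def \<omega>_def by simp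
      then have "128 * real K * frob_inner T T \<le> \<Phi>" using r by simp
      moreover have "128 * \<kappa> * frob_inner T T \<le> 128 * real K * frob_inner T T"
        using K frob_inner_nonneg[OF T] by (intro mult_right_mono) auto
      ultimately show ?thesis by simp
    qed
    define H where "H = Astar - A"
    have H: "H \<in> carrier_mat m n" using As Ac by (auto simp: H_def minus_carrier_mat)
    have GH: "frob_inner G H \<le> - \<Delta> - (\<alpha> / 4) * frob_inner H H"
    proof -
      \<comment> \<open>With Young weight \<open>8 * \<kappa>\<close> the distance term, multiplied
        by \<beta>, costs \<open>\<alpha> / 4\<close>, half of the strong convexity;
        \<open>k = 32 * (K * r)\<close> keeps the penalty term at \<open>\<Phi> / 2\<close>.\<close>
      have "frob_inner WA Astar \<le> 8 * \<kappa> * (2 * real r / real k) * \<Phi> + 2 * frob_inner H H / (8 * \<kappa>)"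
        unfolding \<Phi>_def \<omega>_def WA_def H_def
        using \<kappa>1 by (intro penalty_gradient_inner_le[OF svd A(2) Ac A(3) Astar]) auto
      also have "8 * \<kappa> * (2 * real r / real k) * \<Phi> \<le> \<Phi> / 2"
      proof -
        have "8 * \<kappa> * (2 * real r / real k) = \<kappa> / (2 * real K)" using r by (simp add: k_def)
        also have "\<dots> \<le> 1 / 2" using K K0 by (simp add: field_simps)
        finally have "8 * \<kappa> * (2 * real r / real k) * \<Phi> \<le> 1 / 2 * \<Phi>" using \<Phi>0 by (rule mult_right_mono)
        then show ?thesis by simp
      qed
      finally have "frob_inner WA Astar \<le> \<Phi> / 2 + frob_inner H H / (4 * \<kappa>)" by simp
      then have "\<beta> * frob_inner WA Astar \<le> \<beta> * (\<Phi> / 2 + frob_inner H H / (4 * \<kappa>))"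
        using \<beta> by (intro mult_left_mono) auto
      also have "\<dots> = \<beta> * \<Phi> / 2 + (\<alpha> / 4) * frob_inner H H"
        using \<alpha> \<beta> by (simp add: \<kappa>_def field_simps)
      finally have "\<beta> * frob_inner WA Astar \<le> \<beta> * \<Phi> / 2 + (\<alpha> / 4) * frob_inner H H" .
      moreover have "frob_inner WA A = \<Phi>"
        unfolding WA_def frob_inner_conj_diag[OF cU Ac] \<Phi>_def by (intro sum.cong) (auto simp: z)
      then have "\<beta> * frob_inner WA H = \<beta> * frob_inner WA Astar - \<beta> * \<Phi>"
        using WA As Ac by (simp add: H_def frob_inner_linear[of _ m n] right_diff_distrib)
      moreover have "f Astar \<ge> f A + frob_inner (f' A) H + (\<alpha> / 2) * frob_inner H H"
        unfolding H_def by (rule strongly_convex_funD[OF f(2) Ac As])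
      moreover have "frob_inner G H = frob_inner (f' A) H + \<beta> * frob_inner WA H"
        using f(3) WA H unfolding G_def WA_def[symmetric] by (simp add: frob_inner_linear[of _ m n])
      ultimately show ?thesis by (simp add: \<Delta>_def h)
    qed
    define X where "X = (1 - \<theta>) \<cdot>\<^sub>m (A + T) + \<theta> \<cdot>\<^sub>m Astar"
    have "factors_through m n (s - r + r) X"
      unfolding X_def AT
      by (intro factors_through_add factors_through_smult factors_through_head_proj Astar cU Ac)
    then have X: "factors_through m n s X" by (simp add: s_def)
    have XA: "X - A = (1 - \<theta>) \<cdot>\<^sub>m T + \<theta> \<cdot>\<^sub>m H"
      using Ac T As by (intro eq_matI) (auto simp: X_def H_def algebra_simps)
    define x where "x = 1 / \<kappa>"
    have x: "0 < x" "x \<le> 1" "\<beta> * x = \<alpha>" and \<theta>x: "\<theta> = x / 8"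
      using \<kappa>1 \<alpha> \<beta> by (auto simp: x_def \<theta>_def \<kappa>_def)
    have \<Delta>x: "0 \<le> \<Delta> * x" using \<Delta>0 x by simp
    have \<beta>TT: "\<beta> * frob_inner T T \<le> \<Delta> * x / 64"
    proof -
      have "\<beta> * (128 * \<kappa> * frob_inner T T) \<le> 2 * \<Delta>"
        using TT \<Phi>\<Delta> \<beta> by (meson mult_left_mono order_trans less_imp_le)
      then have "x * (\<beta> * (128 * \<kappa> * frob_inner T T)) \<le> x * (2 * \<Delta>)" using x by (intro mult_left_mono) auto
      moreover have "x * (\<beta> * (128 * \<kappa> * frob_inner T T)) = 128 * (\<beta> * frob_inner T T)"
        using \<kappa>1 by (simp add: x_def)
      ultimately have "128 * (\<beta> * frob_inner T T) \<le> x * (2 * \<Delta>)" by (simp only:)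
      then show ?thesis by (simp add: mult.commute)
    qed
    \<comment> \<open>\<open>T\<close> lies in the range of the projection, so \<open>G\<close>
      enters only through \<open>PG\<close>, which is small in this case.\<close>
    have GT: "frob_inner G T \<le> \<Delta> * x / 32"
    proof -
      have "2 * frob_inner PG T \<le> 1 / (2 * \<beta>) * frob_inner PG PG + frob_inner T T / (1 / (2 * \<beta>))"
        using \<beta> by (intro young_frob_inner[OF PG T]) auto
      moreover have "1 / (2 * \<beta>) * frob_inner PG PG = 2 * (frob_inner PG PG / (4 * \<beta>))" by simp
      moreover have "\<Delta> / (64 * \<kappa>) = \<Delta> * x / 64" by (simp add: x_def)
      moreover have "frob_inner T T / (1 / (2 * \<beta>)) = 2 * (\<beta> * frob_inner T T)" by simp
      moreover have "frob_inner G T = frob_inner PG T" using GPX[OF T] by (simp add: PT)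
      ultimately show ?thesis using 2 \<beta>TT by linarith
    qed
    have "(1 - \<theta>) * frob_inner G T \<le> (1 - \<theta>) * (\<Delta> * x / 32)"
      using GT \<theta> by (intro mult_left_mono) auto
    also have "\<dots> \<le> \<Delta> * x / 32" using \<Delta>x \<theta> by (intro mult_left_le_one_le) auto
    finally have a: "(1 - \<theta>) * frob_inner G T \<le> \<Delta> * x / 32" .
    have b: "\<theta> * frob_inner G H \<le> - (\<Delta> * x / 8) - x * \<alpha> / 32 * frob_inner H H"
      using mult_left_mono[OF GH \<theta>(1)] by (simp add: \<theta>x algebra_simps)
    have "frob_inner (X - A) (X - A)
        \<le> 2 * ((1 - \<theta>)\<^sup>2 * frob_inner T T) + 2 * (\<theta>\<^sup>2 * frob_inner H H)"
      using frob_inner_add_le[of "(1 - \<theta>) \<cdot>\<^sub>m T" m n "\<theta> \<cdot>\<^sub>m H"] T H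
      by (simp add: XA frob_inner_linear[of _ m n] power2_eq_square mult.assoc)
    also have "(1 - \<theta>)\<^sup>2 * frob_inner T T \<le> frob_inner T T"
      using \<theta> frob_inner_nonneg[OF T] by (intro mult_left_le_one_le) (auto intro: power_le_one)
    finally have "\<beta> * frob_inner (X - A) (X - A) \<le> \<beta> * (2 * frob_inner T T + 2 * (\<theta>\<^sup>2 * frob_inner H H))"
      using \<beta> by (intro mult_left_mono) auto
    also have "\<dots> = 2 * (\<beta> * frob_inner T T) + x * (\<beta> * x) / 32 * frob_inner H H"
      by (simp add: \<theta>x power2_eq_square algebra_simps)
    finally have c: "\<beta> * frob_inner (X - A) (X - A) \<le> \<Delta> * x / 32 + x * \<alpha> / 32 * frob_inner H H"
      unfolding x(3) using \<beta>TT by linarith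
    have "frob_inner G (X - A) = (1 - \<theta>) * frob_inner G T + \<theta> * frob_inner G H"
      using G T H by (simp add: XA frob_inner_linear[of _ m n])
    \<comment> \<open>The multiples of \<open>\<Delta> * x\<close> are 1/32 - 1/8 + 1/32, and the
      terms in \<open>frob_inner H H\<close> cancel.\<close>
    then have "q X \<le> h - \<Delta> * x / 16" using a b c unfolding q_def by linarith
    moreover have "\<Delta> / (64 * \<kappa>) = \<Delta> * x / 64" by (simp add: x_def)
    ultimately have "q X \<le> h - \<Delta> / (64 * \<kappa>)" using \<Delta>x by linarith
    then show ?thesis using X by blast
  qed
  then have "penalized m f \<beta> \<omega> U' A' \<le> h - \<Delta> / (64 * \<kappa>)" using best by force
  then show ?thesis by (simp add: \<Delta>_def algebra_simps flip: h_def)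
qed

section \<open>Total correctness with cost bounds\<close>

definition achieves :: "oracles \<Rightarrow> prog \<Rightarrow> state \<Rightarrow> nat \<Rightarrow> (state \<Rightarrow> bool) \<Rightarrow> bool" where
  "achieves E p s T Q \<longleftrightarrow> (\<exists>t s'. run E p s t s' \<and> t \<le> T \<and> Q s')"

lemma achieves_mono:
  assumes "achieves E p s T Q" "T \<le> T'" "\<And>s'. Q s' \<Longrightarrow> Q' s'"
  shows "achieves E p s T' Q'"
  using assms unfolding achieves_def by (meson order_trans)

lemma achieves_Seq:
  assumes "achieves E p s T Q" "\<And>s'. Q s' \<Longrightarrow> achieves E q s' U R"
  shows "achieves E (Seq p q) s (T + U) R"
  using assms unfolding achieves_def by (meson add_mono run_Seq)

text \<open>The invariant is indexed by the number of completed rounds, so this index is also the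
  variant: a true guard must force it below \<open>N\<close>. Induction on the remaining rounds; the
  extra 1 pays for the failing test.\<close>

lemma achieves_While:
  assumes step: "\<And>j s. I j s \<Longrightarrow> bval b s \<Longrightarrow> j < N \<and> achieves E p s T (I (Suc j))" and "I 0 s"
  shows "achieves E (While b p) s (1 + N * (1 + T)) (\<lambda>s'. \<exists>j\<le>N. I j s' \<and> \<not> bval b s')"
proof -
  have "achieves E (While b p) s (1 + l * (1 + T)) (\<lambda>s'. \<exists>j\<le>N. I j s' \<and> \<not> bval b s')"
    if "I j s" "j + l = N" for j l s
    using that
  proof (induction l arbitrary: j s)
    case 0
    then have "\<not> bval b s" using step by fastforce
    then show ?case using 0 run_WhileFalse[of b s E p] unfolding achieves_def
      by (intro exI[of _ 1] exI[of _ s]) auto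
  next
    case (Suc l)
    show ?case
    proof (cases "bval b s")
      case True
      then obtain t s' where t: "run E p s t s'" "t \<le> T" "I (Suc j) s'"
        using step[OF Suc.prems(1)] unfolding achieves_def by blast
      then obtain u s'' where u: "run E (While b p) s' u s''" "u \<le> 1 + l * (1 + T)"
          "\<exists>j\<le>N. I j s'' \<and> \<not> bval b s''"
        using Suc.IH[OF t(3)] Suc.prems(2) unfolding achieves_def by auto
      have "run E (While b p) s (1 + t + u) s''" using True t(1) u(1) by (rule run_WhileTrue)
      moreover have "1 + t + u \<le> 1 + Suc l * (1 + T)" using t(2) u(2) by simp
      ultimately show ?thesis using u(3) unfolding achieves_def by blast
    next
      case False
      have "j \<le> N" using Suc.prems(2) by simp
      then show ?thesis using False Suc.prems(1) run_WhileFalse[OF False] unfolding achieves_def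
        by (intro exI[of _ 1] exI[of _ s]) auto
    qed
  qed
  from this[of 0 s N] show ?thesis using assms(2) by simp
qed

text \<open>The first instruction is a separate argument because there is no empty program.\<close>

fun block :: "instr \<Rightarrow> instr list \<Rightarrow> prog" where
  "block i [] = Do i"
| "block i (j # js) = Seq (Do i) (block j js)"

text \<open>A weakest precondition that the simplifier can evaluate by symbolic execution; one bound
  \<open>c\<close> for every instruction replaces exact cost accounting.\<close>

fun block_post :: "oracles \<Rightarrow> nat \<Rightarrow> instr list \<Rightarrow> state \<Rightarrow> (state \<Rightarrow> bool) \<Rightarrow> bool" where
  "block_post E c [] s Q \<longleftrightarrow> Q s"
| "block_post E c (i # is) s Q \<longleftrightarrow>
    (case exec E i s of None \<Rightarrow> False | Some (s', t) \<Rightarrow> t \<le> c \<and> block_post E c is s' Q)"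

lemma block_post_append:
  "block_post E c (is @ js) s Q \<longleftrightarrow> block_post E c is s (\<lambda>s'. block_post E c js s' Q)"
  by (induction "is" arbitrary: s) (auto split: option.split)

lemma block_post_mono:
  assumes "block_post E c is s Q" "\<And>s'. Q s' \<Longrightarrow> R s'"
  shows "block_post E c is s R"
  using assms by (induction "is" arbitrary: s) (auto split: option.splits)

lemma achieves_block:
  assumes "block_post E c (i # is) s Q"
  shows "achieves E (block i is) s (Suc (length is) * c) Q"
  using assms
proof (induction "is" arbitrary: i s)
  case Nil
  then show ?case unfolding achieves_def by (auto split: option.splits intro: run_Do)
next
  case (Cons j js)
  then obtain s' t where t: "exec E i s = Some (s', t)" "t \<le> c" and post: "block_post E c (j # js) s' Q"
    by (auto split: option.splits simp del: block_post.simps(2) simp: block_post.simps(2)[of _ _ i])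
  have "achieves E (Do i) s c (\<lambda>u. u = s')" using t unfolding achieves_def by (auto intro: run_Do)
  then have "achieves E (Seq (Do i) (block j js)) s (c + Suc (length js) * c) Q"
    by (rule achieves_Seq) (use Cons.IH[OF post] in simp)
  then show ?case by simp
qed


section \<open>The algorithm\<close>

text \<open>Natural expressions have no product, so constant multiples are built from repeated
  doubling.\<close>

definition double :: "nexp \<Rightarrow> nexp" where
  "double e = NPlus e e"

lemma nval_double_funpow [simp]: "nval ((double ^^ j) e) s = 2 ^ j * nval e s"
  by (induction j) (auto simp: double_def)

text \<open>Expressions offer no rounding, so an integer \<open>K \<ge> \<beta> / \<alpha>\<close>
  is found by counting in register 3, while register 4 accumulates \<open>K * r\<close> by
  addition.\<close>

definition count_loop :: prog where
  "count_loop = While (BLess (RTimes (ROfNat (NVar 3)) (RVar 0)) (RVar 1))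
     (block (NAssign 3 (NPlus (NVar 3) (NConst 1))) [NAssign 4 (NPlus (NVar 4) (NVar 2))])"

text \<open>On naturals \<open>x - (x - y)\<close> is the minimum of \<open>x\<close> and \<open>y\<close>, by truncation.\<close>

definition parameters_block :: "instr list" where
  "parameters_block =
    [NAssign 5 ((double ^^ 5) (NVar 4)),
     NAssign 6 (NPlus ((double ^^ 1) (NVar 2)) (NPlus ((double ^^ 2) (NVar 5)) (NVar 5))),
     NAssign 7 (NMinus (NVar 0) (NMinus (NVar 0) (NVar 6))),
     Zero 4 (NVar 0) (NVar 0),
     Objective 4 0]"

definition weights_loop :: prog where
  "weights_loop = While (BLess (ROfNat (NVar 8)) (ROfNat (NVar 0)))
     (block (SetEntry 4 (NVar 8) (NVar 8)
         (RDivide (ROfNat (NMinus (NVar 5) (NMinus (NVar 5) (NMinus (NVar 8) (NVar 2))))) (ROfNat (NVar 5))))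
       [NAssign 8 (NPlus (NVar 8) (NConst 1))])"

text \<open>Matrix register 0 is the iterate and 4 the diagonal of weights; register 5 ends up with
  the iterate after a gradient step of length \<open>1 / (2 * \<beta>)\<close>, matching the
  smoothness constant \<open>2 * \<beta>\<close>.\<close>

definition gradient_block :: "instr list" where
  "gradient_block =
    [SVD 1 2 3 0, Product 5 1 4, Transpose 6 1, Product 5 5 6, Product 5 5 0, Scale 5 (RVar 1) 5,
     Gradient 6 0, Sum 5 6 5, Scale 5 (RDivide (RConst (- 1)) (RTimes (RConst 2) (RVar 1))) 5, Sum 5 0 5]"

text \<open>Natural register 7 holds the target rank capped at the number of rows;
  \<open>Columns\<close> would be stuck on a larger index.\<close>

definition truncation_block :: "instr list" where
  "truncation_block =
    [SVD 1 2 3 5, Columns 1 1 (NConst 0) (NVar 7), Transpose 2 1, Product 2 2 5, Product 0 1 2, Objective 4 0]"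

text \<open>The guard tests \<open>f\<close> itself, which the penalized objective dominates; a
  small penalized gap therefore ends the loop.\<close>

definition descent_loop :: prog where
  "descent_loop = While (BLess (RPlus (RVar 3) (RVar 2)) (RVar 4))
     (block (hd gradient_block) (tl gradient_block @ truncation_block))"

definition descent_algorithm :: prog where
  "descent_algorithm =
    Seq (block (Zero 0 (NVar 0) (NVar 1)) [])
     (Seq count_loop
       (Seq (block (hd parameters_block) (tl parameters_block))
         (Seq weights_loop descent_loop)))"

section \<open>Correctness and cost of the pieces of the program\<close>

text \<open>One cubic bound for the cost shapes occurring in the blocks, as required by
  \<open>block_post\<close>.\<close>

lemma cost_bounds:
  fixes m n p N :: nat
  assumes "m \<le> N" "n \<le> N" "p \<le> N" "1 \<le> N"
  shows "1 + m * n \<le> 4 * N ^ 3" "1 + m * (1 + n) * p \<le> 4 * N ^ 3"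
    "1 + m * m + m * n + n * n \<le> 4 * N ^ 3" "1 \<le> 4 * N ^ 3"
proof -
  have N: "1 \<le> N ^ 3" "N * N \<le> N ^ 3" "N * N * N = N ^ 3"
    using assms(4) by (auto simp: power3_eq_cube)
  have le: "m * n \<le> N * N" "m * m \<le> N * N" "n * n \<le> N * N" "m * p \<le> N * N" "m * n * p \<le> N * N * N"
    using assms by (auto intro!: mult_le_mono)
  have "m * (1 + n) * p = m * p + m * n * p" by (simp add: algebra_simps)
  then show "1 + m * (1 + n) * p \<le> 4 * N ^ 3" using N le by linarith
  show "1 + m * n \<le> 4 * N ^ 3" "1 + m * m + m * n + n * n \<le> 4 * N ^ 3" "1 \<le> 4 * N ^ 3"
    using N le by linarith+
qed

lemma gradient_block_post:
  assumes E: "valid_oracles m n f f' \<beta> E" and A: "A \<in> carrier_mat m n" "f' A \<in> carrier_mat m n"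
    and s: "mreg s 0 = A" "mreg s 4 = D" "D \<in> carrier_mat m m" "rreg s 1 = \<beta>"
    and svd: "svd E A = (U, S, V)" and N: "m \<le> N" "n \<le> N" "1 \<le> N"
  defines "Z \<equiv> A - (1 / (2 * \<beta>)) \<cdot>\<^sub>m (f' A + \<beta> \<cdot>\<^sub>m (U * D * transpose_mat U * A))"
  shows "block_post E (4 * N ^ 3) gradient_block s
    (\<lambda>s'. nreg s' = nreg s \<and> rreg s' = rreg s \<and> mreg s' 0 = A \<and> mreg s' 4 = D \<and> mreg s' 5 = Z)"
proof -
  have dims: "dim_row A = m" "dim_col A = n" "dim_row D = m" "dim_col D = m"
      "dim_row (f' A) = m" "dim_col (f' A) = n" "nrows E = m" "ncols E = n"
    using A s E by (auto simp: valid_oracles_def)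
  have "is_svd A (U, S, V)" using E svd by (metis valid_oracles_def)
  then have U: "dim_row U = m" "dim_col U = m" using dims by (auto simp: is_svd_def)
  have grad: "gradient E A = f' A" using E A by (simp add: valid_oracles_def)
  have Z: "Z = A + (- 1 / (2 * \<beta>)) \<cdot>\<^sub>m (f' A + \<beta> \<cdot>\<^sub>m (U * D * transpose_mat U * A))"
    using dims U by (intro eq_matI) (auto simp: Z_def)
  note costs = cost_bounds[OF N(1) N(2) N(1) N(3)] cost_bounds[OF N(1) N(1) N(2) N(3)]
    cost_bounds[OF N(1) N(1) N(1) N(3)] cost_bounds[OF N(1) N(2) N(2) N(3)]
  show ?thesis
    unfolding gradient_block_def Z
    by (simp add: s svd dims U grad A(1) Let_def del: One_nat_def)
      (use costs in \<open>simp add: algebra_simps\<close>)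
qed

lemma truncation_block_post:
  assumes E: "valid_oracles m n f f' \<beta> E" and Z: "Z \<in> carrier_mat m n"
    and s: "mreg s 5 = Z" "nreg s 7 = min l m"
    and svd: "svd E Z = (U, S, V)" and N: "m \<le> N" "n \<le> N" "1 \<le> N"
  defines "Us \<equiv> mat m (min l m) (($$) U)"
  defines "B \<equiv> Us * (transpose_mat Us * Z)"
  shows "block_post E (4 * N ^ 3) truncation_block s
    (\<lambda>s'. nreg s' = nreg s \<and> rreg s' = (rreg s)(4 := f B) \<and> mreg s' 0 = B \<and> mreg s' 4 = mreg s 4)"
proof -
  have dims: "dim_row Z = m" "dim_col Z = n" "nrows E = m" "ncols E = n" "dim_row Us = m" "dim_col Us = min l m"
    using Z E by (auto simp: valid_oracles_def Us_def)
  have "is_svd Z (U, S, V)" using E svd by (metis valid_oracles_def)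
  then have U: "dim_row U = m" "dim_col U = m" using dims by (auto simp: is_svd_def)
  have B: "B \<in> carrier_mat m n" using dims by (auto simp: B_def)
  then have obj: "objective E B = f B" using E by (simp add: valid_oracles_def)
  have p: "min l m \<le> N" using N by simp
  note costs = cost_bounds[OF N(1) N(2) N(1) N(3)] cost_bounds[OF p N(1) N(2) N(3)]
    cost_bounds[OF N(1) p N(2) N(3)] cost_bounds[OF p N(2) N(2) N(3)]
  show ?thesis
    unfolding truncation_block_def
    by (simp add: s svd dims U Let_def B obj del: One_nat_def flip: Us_def B_def)
      (use costs in \<open>simp add: algebra_simps\<close>)
qed

lemma count_loop_achieves:
  fixes s :: state
  assumes \<alpha>: "\<alpha> > 0" and s: "rreg s 0 = \<alpha>" "rreg s 1 = \<beta>" "nreg s 3 = 0" "nreg s 4 = 0" "nreg s 2 = r"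
  shows "achieves E count_loop s (1 + nat \<lceil>\<beta> / \<alpha>\<rceil> * 3)
    (\<lambda>s'. \<exists>K\<le>nat \<lceil>\<beta> / \<alpha>\<rceil>. \<beta> / \<alpha> \<le> real K \<and> nreg s' 4 = K * r \<and>
      (\<forall>i. i \<noteq> 3 \<and> i \<noteq> 4 \<longrightarrow> nreg s' i = nreg s i) \<and> rreg s' = rreg s \<and> mreg s' = mreg s)"
proof -
  let ?b = "BLess (RTimes (ROfNat (NVar 3)) (RVar 0)) (RVar 1)"
  let ?I = "\<lambda>j s'. nreg s' 3 = j \<and> nreg s' 4 = j * r \<and>
      (\<forall>i. i \<noteq> 3 \<and> i \<noteq> 4 \<longrightarrow> nreg s' i = nreg s i) \<and> rreg s' = rreg s \<and> mreg s' = mreg s"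
  have "achieves E count_loop s (1 + nat \<lceil>\<beta> / \<alpha>\<rceil> * (1 + 2))
      (\<lambda>s'. \<exists>j\<le>nat \<lceil>\<beta> / \<alpha>\<rceil>. ?I j s' \<and> \<not> bval ?b s')"
    unfolding count_loop_def
  proof (rule achieves_While, intro conjI)
    fix j and s' :: state assume I: "?I j s'" and "bval ?b s'"
    then have "real j < \<beta> / \<alpha>" using s \<alpha> by (simp add: field_simps)
    then show "j < nat \<lceil>\<beta> / \<alpha>\<rceil>" by linarith
    have "achieves E (block (NAssign 3 (NPlus (NVar 3) (NConst 1))) [NAssign 4 (NPlus (NVar 4) (NVar 2))]) s'
        (Suc (length [NAssign 4 (NPlus (NVar 4) (NVar 2))]) * 1) (?I (Suc j))"
      by (rule achieves_block) (use I s in auto)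
    then show "achieves E (block (NAssign 3 (NPlus (NVar 3) (NConst 1))) [NAssign 4 (NPlus (NVar 4) (NVar 2))]) s' 2
        (?I (Suc j))" by (rule achieves_mono) simp_all
  qed (use s in auto)
  then show ?thesis
  proof (rule achieves_mono)
    fix s' :: state assume "\<exists>j\<le>nat \<lceil>\<beta> / \<alpha>\<rceil>. ?I j s' \<and> \<not> bval ?b s'"
    then obtain j where j: "j \<le> nat \<lceil>\<beta> / \<alpha>\<rceil>" "?I j s'" "\<not> bval ?b s'" by blast
    then have "\<beta> / \<alpha> \<le> real j" using s \<alpha> by (simp add: field_simps)
    then show "\<exists>K\<le>nat \<lceil>\<beta> / \<alpha>\<rceil>. \<beta> / \<alpha> \<le> real K \<and> nreg s' 4 = K * r \<and>
      (\<forall>i. i \<noteq> 3 \<and> i \<noteq> 4 \<longrightarrow> nreg s' i = nreg s i) \<and> rreg s' = rreg s \<and> mreg s' = mreg s"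
      using j by blast
  qed simp
qed

text \<open>With \<open>k = 2^5 p\<close> the target rank is assembled as
  \<open>2 r + (4 k + k)\<close>, that is \<open>2 r + 160 p\<close>.\<close>

lemma parameters_block_post:
  assumes E: "valid_oracles m n f f' \<beta> E" and A: "A \<in> carrier_mat m n" "mreg s 0 = A"
    and s: "nreg s 0 = m" "nreg s 2 = r" "nreg s 4 = p" and N: "m \<le> N" "1 \<le> N"
  shows "block_post E (4 * N ^ 3) parameters_block s
    (\<lambda>s'. nreg s' 5 = 32 * p \<and> nreg s' 7 = min (2 * r + 160 * p) m \<and>
      (\<forall>i\<in>{0, 2, 8}. nreg s' i = nreg s i) \<and> rreg s' = (rreg s)(4 := f A) \<and>
      mreg s' 0 = A \<and> mreg s' 4 = 0\<^sub>m m m)"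
proof -
  have dims: "nrows E = m" "ncols E = n" "objective E A = f A" using E A by (auto simp: valid_oracles_def)
  show ?thesis
    unfolding parameters_block_def
    by (simp add: A s dims Let_def del: One_nat_def funpow.simps)
      (use cost_bounds[OF N(1) N(1) N(1) N(2)] in simp)
qed

lemma weights_loop_achieves:
  assumes s: "nreg s 0 = m" "nreg s 2 = r" "nreg s 5 = k" "nreg s 8 = 0" "mreg s 4 = 0\<^sub>m m m"
  shows "achieves E weights_loop s (1 + m * 3)
    (\<lambda>s'. mreg s' 4 = mat_diag m (penalty_weight r k) \<and> mreg s' 0 = mreg s 0 \<and> rreg s' = rreg s \<and>
      (\<forall>i. i \<noteq> 8 \<longrightarrow> nreg s' i = nreg s i))"
proof -
  let ?b = "BLess (ROfNat (NVar 8)) (ROfNat (NVar 0))"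
  let ?e = "RDivide (ROfNat (NMinus (NVar 5) (NMinus (NVar 5) (NMinus (NVar 8) (NVar 2))))) (ROfNat (NVar 5))"
  \<comment> \<open>The weight matrix after \<open>j\<close> rounds: the first \<open>j\<close>
    diagonal entries are filled in.\<close>
  define D where "D j = mat m m (\<lambda>(i, l). if i = l \<and> i < j then penalty_weight r k i else 0)" for j
  have dims: "dim_row (D j) = m" "dim_col (D j) = m" for j by (auto simp: D_def)
  let ?I = "\<lambda>j s'. nreg s' 8 = j \<and> mreg s' 4 = D j \<and> mreg s' 0 = mreg s 0 \<and> rreg s' = rreg s \<and>
      (\<forall>i. i \<noteq> 8 \<longrightarrow> nreg s' i = nreg s i)"
  have "achieves E weights_loop s (1 + m * (1 + 2)) (\<lambda>s'. \<exists>j\<le>m. ?I j s' \<and> \<not> bval ?b s')"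
    unfolding weights_loop_def
  proof (rule achieves_While, intro conjI)
    fix j and s' :: state assume I: "?I j s'" and "bval ?b s'"
    then show j: "j < m" using s by simp
    have "k - (k - (j - r)) = min k (j - r)" by simp
    then have e: "rval ?e s' = penalty_weight r k j" using I s by (simp add: penalty_weight_def)
    have D: "mat m m (\<lambda>p. if p = (j, j) then rval ?e s' else D j $$ p) = D (Suc j)"
      unfolding e using j by (intro eq_matI) (auto simp: D_def)
    have "achieves E (block (SetEntry 4 (NVar 8) (NVar 8) ?e) [NAssign 8 (NPlus (NVar 8) (NConst 1))]) s'
        (Suc (length [NAssign 8 (NPlus (NVar 8) (NConst 1))]) * 1) (?I (Suc j))"
      by (rule achieves_block) (use I j s D in \<open>auto simp: Let_def dims\<close>)
    then show "achieves E (block (SetEntry 4 (NVar 8) (NVar 8) ?e) [NAssign 8 (NPlus (NVar 8) (NConst 1))]) s' 2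
        (?I (Suc j))" by (rule achieves_mono) simp_all
  next
    have "D 0 = 0\<^sub>m m m" by (intro eq_matI) (auto simp: D_def)
    then show "?I 0 s" using s by simp
  qed
  then show ?thesis
  proof (rule achieves_mono)
    fix s' :: state assume "\<exists>j\<le>m. ?I j s' \<and> \<not> bval ?b s'"
    then have "?I m s'" using s by fastforce
    moreover have "D m = mat_diag m (penalty_weight r k)" by (intro eq_matI) (auto simp: D_def mat_diag_def)
    ultimately show "mreg s' 4 = mat_diag m (penalty_weight r k) \<and> mreg s' 0 = mreg s 0 \<and> rreg s' = rreg s \<and>
      (\<forall>i. i \<noteq> 8 \<longrightarrow> nreg s' i = nreg s i)" by simp
  qed simp
qed

text \<open>The penalized gap of the current iterate shrinks geometrically; it is taken over all singular value
  decompositions of the iterate, as the oracle's choice for it is made only in the next round.\<close>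

lemma descent_loop_achieves:
  fixes m n K r :: nat and f :: "real mat \<Rightarrow> real" and Astar :: "real mat" and \<alpha> \<beta> \<epsilon> :: real
  defines "\<kappa> \<equiv> \<beta> / \<alpha>" and "k \<equiv> 32 * (K * r)" and "l \<equiv> 2 * r + 160 * (K * r)"
  defines "L \<equiv> log_gap (f (0\<^sub>m m n) - f Astar) \<epsilon>"
  assumes E: "valid_oracles m n f f' \<beta> E" and grad: "gradient_of m n f f'"
    and f: "smooth_fun m n f f' \<beta>" "strongly_convex_fun m n f f' \<alpha>"
    and \<alpha>: "\<alpha> > 0" "\<alpha> \<le> \<beta>" and K: "\<kappa> \<le> real K" and r: "r \<ge> 1" and \<epsilon>: "\<epsilon> > 0"
    and Astar: "factors_through m n r Astar"
    and s: "nreg s 7 = min l m" "rreg s 1 = \<beta>" "rreg s 2 = \<epsilon>" "rreg s 3 = f Astar" "rreg s 4 = f (0\<^sub>m m n)"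
      "mreg s 0 = 0\<^sub>m m n" "mreg s 4 = mat_diag m (penalty_weight r k)"
    and N: "m \<le> N" "n \<le> N" "1 \<le> N"
  shows "achieves E descent_loop s (1 + nat \<lceil>64 * \<kappa> * L\<rceil> * (1 + 16 * (4 * N ^ 3)))
    (\<lambda>s'. factors_through m n l (mreg s' 0) \<and> f (mreg s' 0) \<le> f Astar + \<epsilon>)"
proof -
  let ?b = "BLess (RPlus (RVar 3) (RVar 2)) (RVar 4)"
  define \<omega> where "\<omega> = penalty_weight r k"
  define gap where "gap = f (0\<^sub>m m n) - f Astar"
  define \<rho> where "\<rho> = 1 - 1 / (64 * \<kappa>)"
  have \<kappa>: "1 \<le> \<kappa>" using \<alpha> by (simp add: \<kappa>_def)
  then have \<rho>: "0 \<le> \<rho>" "\<rho> \<le> 1" by (auto simp: \<rho>_def field_simps)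
  have svd: "is_svd A (svd E A)" for A using E by (simp add: valid_oracles_def)
  then have svd_ex: "\<exists>U S V. is_svd A (U, S, V)" for A by (metis prod.exhaust)
  have pen_ge: "f A \<le> penalized m f \<beta> \<omega> U A" for U A
    using \<alpha> unfolding penalized_def \<omega>_def
    by (auto intro!: mult_nonneg_nonneg sum_nonneg simp: penalty_weight_bounds row_energy_nonneg)
  define I where "I j s' \<longleftrightarrow> nreg s' 7 = min l m \<and> rreg s' 1 = \<beta> \<and> rreg s' 2 = \<epsilon> \<and> rreg s' 3 = f Astar \<and>
      mreg s' 4 = mat_diag m \<omega> \<and> rreg s' 4 = f (mreg s' 0) \<and> factors_through m n l (mreg s' 0) \<and>
      (\<forall>U S V. is_svd (mreg s' 0) (U, S, V) \<longrightarrow> penalized m f \<beta> \<omega> U (mreg s' 0) - f Astar \<le> \<rho> ^ j * gap)"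
    for j and s' :: state
  have "achieves E descent_loop s (1 + nat \<lceil>64 * \<kappa> * L\<rceil> * (1 + 16 * (4 * N ^ 3)))
      (\<lambda>s'. \<exists>j\<le>nat \<lceil>64 * \<kappa> * L\<rceil>. I j s' \<and> \<not> bval ?b s')"
    unfolding descent_loop_def
  proof (rule achieves_While, intro conjI)
    fix j and s' :: state assume I: "I j s'" and "bval ?b s'"
    define A where "A = mreg s' 0"
    have A: "factors_through m n l A" using I by (simp add: I_def A_def)
    note Ac = factors_through_carrier[OF A]
    obtain U S V where USV: "svd E A = (U, S, V)" by (metis prod.exhaust)
    have svdA: "is_svd A (U, S, V)" using svd[of A] by (simp add: USV)
    have big: "f Astar + \<epsilon> < f A" using I \<open>bval ?b s'\<close> by (simp add: I_def A_def)
    have pen: "penalized m f \<beta> \<omega> U A - f Astar \<le> \<rho> ^ j * gap"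
      using I svdA by (auto simp: I_def A_def)
    \<comment> \<open>Otherwise \<open>1 - x \<le> exp (- x)\<close> with
      \<open>x = 1 / (64 * \<kappa>)\<close> bounds the penalized gap by \<epsilon>, which
      contradicts the guard. An initial gap of at most \<epsilon>, possibly negative, is handled
      separately, as \<open>L\<close> is then 0.\<close>
    show "j < nat \<lceil>64 * \<kappa> * L\<rceil>"
    proof (rule ccontr)
      assume "\<not> j < nat \<lceil>64 * \<kappa> * L\<rceil>"
      then have j: "64 * \<kappa> * L \<le> real j" by linarith
      have "\<rho> ^ j * gap \<le> \<epsilon>"
      proof (cases "gap \<le> \<epsilon>")
        case True
        have "\<rho> ^ j * gap \<le> \<rho> ^ j * \<epsilon>" using True \<rho> by (intro mult_left_mono) auto
        also have "\<dots> \<le> 1 * \<epsilon>" using \<rho> \<epsilon> by (intro mult_right_mono power_le_one) auto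
        finally show ?thesis by simp
      next
        case False
        then have L: "L = ln (gap / \<epsilon>)" by (simp add: L_def log_gap_def gap_def)
        have "\<rho> \<le> exp (- (1 / (64 * \<kappa>)))" using exp_ge_add_one_self[of "- (1 / (64 * \<kappa>))"] by (simp add: \<rho>_def)
        then have "\<rho> ^ j \<le> exp (- (1 / (64 * \<kappa>))) ^ j" using \<rho> by (intro power_mono) auto
        also have "\<dots> = exp (- (real j / (64 * \<kappa>)))" by (simp flip: exp_of_nat_mult)
        also have "\<dots> \<le> exp (- L)" using j \<kappa> by (simp add: field_simps)
        also have "\<dots> = \<epsilon> / gap" using False \<epsilon> by (simp add: L exp_minus)
        finally show ?thesis using False \<epsilon> by (simp add: field_simps)
      qed
      then show False using pen pen_ge[of A U] big by linarith
    qed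
    define Z where "Z = A - (1 / (2 * \<beta>)) \<cdot>\<^sub>m (f' A + \<beta> \<cdot>\<^sub>m (conj_diag m U \<omega> * A))"
    have fA: "f' A \<in> carrier_mat m n" using grad Ac by (auto simp: gradient_of_def has_gradient_def)
    have Zc: "Z \<in> carrier_mat m n"
      using fA Ac svdA unfolding Z_def by (intro minus_carrier_mat) (auto simp: is_svd_def)
    obtain U2 S2 V2 where USV2: "svd E Z = (U2, S2, V2)" by (metis prod.exhaust)
    have svdZ: "is_svd Z (U2, S2, V2)" using svd[of Z] by (simp add: USV2)
    define Us where "Us = mat m (min l m) (($$) U2)"
    define B where "B = Us * (transpose_mat Us * Z)"
    have U2: "U2 \<in> carrier_mat m m" using svdZ Zc by (auto simp: is_svd_def)
    have B: "B = head_proj m U2 l * Z"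
      unfolding B_def Us_def by (rule columns_mult_transpose[OF U2 Zc refl])
    have Bf: "factors_through m n l B" unfolding B by (rule factors_through_head_proj[OF U2 Zc])
    have round: "I (Suc j) u" if u: "nreg u = nreg s'" "rreg u = (rreg s')(4 := f B)" "mreg u 0 = B"
      "mreg u 4 = mat_diag m \<omega>" for u :: state
    proof -
      have "penalized m f \<beta> \<omega> U3 B - f Astar \<le> \<rho> ^ Suc j * gap" if svdB: "is_svd B (U3, S3, V3)" for U3 S3 V3
      proof -
        have "penalized m f \<beta> \<omega> U3 B - f Astar \<le> \<rho> * (penalized m f \<beta> \<omega> U A - f Astar)"
          unfolding \<rho>_def \<kappa>_def \<omega>_def k_def
          by (rule penalized_descent[OF svd_ex f fA \<alpha> K[unfolded \<kappa>_def] r Astar A[unfolded l_def]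
                svd_diagonalizes[OF svdA Ac] _ Z_def[unfolded \<omega>_def k_def] svd_diagonalizes[OF svdZ Zc]
                B[unfolded l_def] svd_diagonalizes[OF svdB factors_through_carrier[OF Bf]]])
            (use big \<epsilon> in auto)
        also have "\<dots> \<le> \<rho> * (\<rho> ^ j * gap)" using pen \<rho> by (intro mult_left_mono) auto
        finally show ?thesis by (simp add: mult.assoc)
      qed
      then show ?thesis using u I Bf by (simp add: I_def)
    qed
    have "block_post E (4 * N ^ 3) (gradient_block @ truncation_block) s' (I (Suc j))"
      unfolding block_post_append
    proof (rule block_post_mono)
      show "block_post E (4 * N ^ 3) gradient_block s'
        (\<lambda>u. nreg u = nreg s' \<and> rreg u = rreg s' \<and> mreg u 0 = A \<and> mreg u 4 = mat_diag m \<omega> \<and> mreg u 5 = Z)"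
        unfolding Z_def conj_diag_def
        by (rule gradient_block_post[OF E Ac fA _ _ _ _ USV N]) (use I in \<open>auto simp: I_def A_def\<close>)
      fix u :: state assume u: "nreg u = nreg s' \<and> rreg u = rreg s' \<and> mreg u 0 = A \<and> mreg u 4 = mat_diag m \<omega> \<and> mreg u 5 = Z"
      show "block_post E (4 * N ^ 3) truncation_block u (I (Suc j))"
      proof (rule block_post_mono)
        show "block_post E (4 * N ^ 3) truncation_block u
          (\<lambda>v. nreg v = nreg u \<and> rreg v = (rreg u)(4 := f B) \<and> mreg v 0 = B \<and> mreg v 4 = mreg u 4)"
          unfolding B_def Us_def
          by (rule truncation_block_post[OF E Zc _ _ USV2 N]) (use I u in \<open>auto simp: I_def\<close>)
      qed (use u in \<open>auto intro: round\<close>)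
    qed
    moreover have "gradient_block @ truncation_block = hd gradient_block # (tl gradient_block @ truncation_block)"
      by (simp add: gradient_block_def)
    ultimately have "block_post E (4 * N ^ 3) (hd gradient_block # (tl gradient_block @ truncation_block)) s' (I (Suc j))"
      by (simp only:)
    from achieves_block[OF this]
    have "achieves E (block (hd gradient_block) (tl gradient_block @ truncation_block)) s'
      (Suc (length (tl gradient_block @ truncation_block)) * (4 * N ^ 3)) (I (Suc j))" .
    moreover have "Suc (length (tl gradient_block @ truncation_block)) = 16"
      by (simp add: gradient_block_def truncation_block_def)
    ultimately show "achieves E (block (hd gradient_block) (tl gradient_block @ truncation_block)) s'
      (16 * (4 * N ^ 3)) (I (Suc j))"
      by (simp only:)
  next
    \<comment> \<open>At the zero matrix the penalty vanishes in every basis, so the initial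
      penalized gap is the gap of \<open>f\<close>.\<close>
    have "row_energy U (0\<^sub>m m n) i = 0" if "is_svd (0\<^sub>m m n) (U, S, V)" "i < m" for U S V i
    proof -
      have "U \<in> carrier_mat m m" using that(1) by (simp add: is_svd_def)
      then show ?thesis using that(2) by (simp add: row_energy_def)
    qed
    then have "penalized m f \<beta> \<omega> U (0\<^sub>m m n) = f (0\<^sub>m m n)" if "is_svd (0\<^sub>m m n) (U, S, V)" for U S V
      using that by (simp add: penalized_def)
    moreover have "factors_through m n l (0\<^sub>m m n)"
      unfolding factors_through_def by (intro conjI exI[of _ "\<lambda>i k. 0"]) auto
    ultimately show "I 0 s" using s by (auto simp: I_def \<omega>_def gap_def)
  qed
  then show ?thesis by (rule achieves_mono) (auto simp: I_def)
qed

text \<open>The summands of the budget follow the five pieces of the program. \<open>K\<close> is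
  existential because the counting loop determines it at run time.\<close>

lemma descent_algorithm_achieves:
  fixes m n r :: nat and f :: "real mat \<Rightarrow> real" and Astar :: "real mat" and \<alpha> \<beta> \<epsilon> :: real
  defines "\<kappa> \<equiv> \<beta> / \<alpha>" and "L \<equiv> log_gap (f (0\<^sub>m m n) - f Astar) \<epsilon>"
  assumes E: "valid_oracles m n f f' \<beta> E" and grad: "gradient_of m n f f'"
    and f: "smooth_fun m n f f' \<beta>" "strongly_convex_fun m n f f' \<alpha>"
    and \<alpha>: "\<alpha> > 0" "\<alpha> \<le> \<beta>" and r: "r \<ge> 1" and \<epsilon>: "\<epsilon> > 0" and mn: "m \<ge> 1"
    and Astar: "factors_through m n r Astar"
  defines "c \<equiv> 4 * (m + n) ^ 3"
  shows "achieves E descent_algorithm (init_state m n r \<alpha> \<beta> \<epsilon> (f Astar))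
    (c + (1 + nat \<lceil>\<kappa>\<rceil> * 3) + 5 * c + (1 + m * 3) + (1 + nat \<lceil>64 * \<kappa> * L\<rceil> * (1 + 16 * c)))
    (\<lambda>s. \<exists>K\<le>nat \<lceil>\<kappa>\<rceil>. factors_through m n (2 * r + 160 * (K * r)) (result_mat s) \<and>
      f (result_mat s) \<le> f Astar + \<epsilon>)"
proof -
  let ?s0 = "init_state m n r \<alpha> \<beta> \<epsilon> (f Astar)"
  let ?Q = "\<lambda>s. \<exists>K\<le>nat \<lceil>\<kappa>\<rceil>. factors_through m n (2 * r + 160 * (K * r)) (result_mat s) \<and>
      f (result_mat s) \<le> f Astar + \<epsilon>"
  have N: "m \<le> m + n" "n \<le> m + n" "1 \<le> m + n" using mn by auto
  have zero: "achieves E (block (Zero 0 (NVar 0) (NVar 1)) []) ?s0 (Suc (length ([] :: instr list)) * c)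
      (\<lambda>s. s = set_mreg 0 (0\<^sub>m m n) ?s0)"
    by (rule achieves_block) (use cost_bounds(1)[OF N(1,2,1,3)] in \<open>simp add: init_state_def c_def\<close>)
  have "achieves E descent_algorithm ?s0
    (Suc (length ([] :: instr list)) * c + ((1 + nat \<lceil>\<kappa>\<rceil> * 3) + (5 * c + ((1 + m * 3) +
      (1 + nat \<lceil>64 * \<kappa> * L\<rceil> * (1 + 16 * c)))))) ?Q"
    unfolding descent_algorithm_def
  proof (rule achieves_Seq[OF zero])
    fix s :: state assume s: "s = set_mreg 0 (0\<^sub>m m n) ?s0"
    have "rreg s 0 = \<alpha>" "rreg s 1 = \<beta>" "nreg s 3 = 0" "nreg s 4 = 0" "nreg s 2 = r"
      by (auto simp: s init_state_def)
    from count_loop_achieves[OF \<alpha>(1) this]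
    show "achieves E (Seq count_loop (Seq (block (hd parameters_block) (tl parameters_block)) (Seq weights_loop descent_loop))) s
      ((1 + nat \<lceil>\<kappa>\<rceil> * 3) + (5 * c + ((1 + m * 3) + (1 + nat \<lceil>64 * \<kappa> * L\<rceil> * (1 + 16 * c))))) ?Q"
      unfolding \<kappa>_def[symmetric]
    proof (rule achieves_Seq)
      fix s1 :: state assume "\<exists>K\<le>nat \<lceil>\<kappa>\<rceil>. \<kappa> \<le> real K \<and> nreg s1 4 = K * r \<and>
        (\<forall>i. i \<noteq> 3 \<and> i \<noteq> 4 \<longrightarrow> nreg s1 i = nreg s i) \<and> rreg s1 = rreg s \<and> mreg s1 = mreg s"
      then obtain K where K: "K \<le> nat \<lceil>\<kappa>\<rceil>" "\<kappa> \<le> real K" "nreg s1 4 = K * r"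
        and s1: "\<forall>i. i \<noteq> 3 \<and> i \<noteq> 4 \<longrightarrow> nreg s1 i = nreg s i" "rreg s1 = rreg s" "mreg s1 = mreg s"
        by blast
      have regs: "mreg s1 0 = 0\<^sub>m m n" "nreg s1 0 = m" "nreg s1 2 = r" "nreg s1 8 = 0"
        "rreg s1 1 = \<beta>" "rreg s1 2 = \<epsilon>" "rreg s1 3 = f Astar"
        using s1 by (auto simp: s init_state_def)
      have "block_post E c (hd parameters_block # tl parameters_block) s1
        (\<lambda>s'. nreg s' 5 = 32 * (K * r) \<and> nreg s' 7 = min (2 * r + 160 * (K * r)) m \<and>
          (\<forall>i\<in>{0, 2, 8}. nreg s' i = nreg s1 i) \<and> rreg s' = (rreg s1)(4 := f (0\<^sub>m m n)) \<and>
          mreg s' 0 = 0\<^sub>m m n \<and> mreg s' 4 = 0\<^sub>m m m)"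
        using parameters_block_post[OF E zero_carrier_mat regs(1,2,3) K(3) N(1,3)]
        by (simp add: parameters_block_def c_def)
      from achieves_block[OF this]
      have "achieves E (block (hd parameters_block) (tl parameters_block)) s1 (5 * c)
        (\<lambda>s'. nreg s' 5 = 32 * (K * r) \<and> nreg s' 7 = min (2 * r + 160 * (K * r)) m \<and>
          (\<forall>i\<in>{0, 2, 8}. nreg s' i = nreg s1 i) \<and> rreg s' = (rreg s1)(4 := f (0\<^sub>m m n)) \<and>
          mreg s' 0 = 0\<^sub>m m n \<and> mreg s' 4 = 0\<^sub>m m m)"
        by (rule achieves_mono) (simp_all add: parameters_block_def)
      then show "achieves E (Seq (block (hd parameters_block) (tl parameters_block)) (Seq weights_loop descent_loop)) s1
        (5 * c + ((1 + m * 3) + (1 + nat \<lceil>64 * \<kappa> * L\<rceil> * (1 + 16 * c)))) ?Q"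
      proof (rule achieves_Seq)
        fix s2 :: state assume s2: "nreg s2 5 = 32 * (K * r) \<and> nreg s2 7 = min (2 * r + 160 * (K * r)) m \<and>
          (\<forall>i\<in>{0, 2, 8}. nreg s2 i = nreg s1 i) \<and> rreg s2 = (rreg s1)(4 := f (0\<^sub>m m n)) \<and>
          mreg s2 0 = 0\<^sub>m m n \<and> mreg s2 4 = 0\<^sub>m m m"
        have "nreg s2 0 = m" "nreg s2 2 = r" "nreg s2 5 = 32 * (K * r)" "nreg s2 8 = 0" "mreg s2 4 = 0\<^sub>m m m"
          using s2 regs by auto
        from weights_loop_achieves[OF this]
        show "achieves E (Seq weights_loop descent_loop) s2
          ((1 + m * 3) + (1 + nat \<lceil>64 * \<kappa> * L\<rceil> * (1 + 16 * c))) ?Q"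
        proof (rule achieves_Seq)
          fix s3 :: state assume s3: "mreg s3 4 = mat_diag m (penalty_weight r (32 * (K * r))) \<and> mreg s3 0 = mreg s2 0 \<and>
            rreg s3 = rreg s2 \<and> (\<forall>i. i \<noteq> 8 \<longrightarrow> nreg s3 i = nreg s2 i)"
          have "achieves E descent_loop s3 (1 + nat \<lceil>64 * \<kappa> * L\<rceil> * (1 + 16 * c))
            (\<lambda>s'. factors_through m n (2 * r + 160 * (K * r)) (mreg s' 0) \<and> f (mreg s' 0) \<le> f Astar + \<epsilon>)"
            unfolding c_def \<kappa>_def L_def
            by (rule descent_loop_achieves[OF E grad f \<alpha> K(2)[unfolded \<kappa>_def] r \<epsilon> Astar _ _ _ _ _ _ _ N])
              (use s2 s3 regs in auto)
          then show "achieves E descent_loop s3 (1 + nat \<lceil>64 * \<kappa> * L\<rceil> * (1 + 16 * c)) ?Q"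
            by (rule achieves_mono) (use K(1) in \<open>auto simp: result_mat_def\<close>)
        qed
      qed
    qed
  qed
  then show ?thesis by (rule achieves_mono) simp_all
qed

section \<open>Polynomial cost and the final rank bound\<close>

lemma log_gap_nonneg: "\<epsilon> > 0 \<Longrightarrow> 0 \<le> log_gap gap \<epsilon>"
  by (simp add: log_gap_def)

text \<open>Degree 5 arises from quadratically many rounds of cubic cost; all lower powers are
  absorbed since the base is at least 1.\<close>

lemma descent_cost_polynomial:
  fixes m n :: nat and \<kappa> L :: real
  assumes "m \<ge> 1" "\<kappa> \<ge> 1" "L \<ge> 0"
  defines "c \<equiv> 4 * (m + n) ^ 3"
  shows "real (c + (1 + nat \<lceil>\<kappa>\<rceil> * 3) + 5 * c + (1 + m * 3) + (1 + nat \<lceil>64 * \<kappa> * L\<rceil> * (1 + 16 * c)))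
    \<le> 5000 * (real m + real n + \<kappa> + L) ^ 5"
proof -
  define x where "x = real m + real n + \<kappa> + L"
  have x: "1 \<le> x" "real m \<le> x" "\<kappa> \<le> x" "L \<le> x" using assms by (auto simp: x_def)
  have pow: "1 \<le> x ^ 5" "x \<le> x ^ 5" "x ^ 2 \<le> x ^ 5" "x ^ 3 \<le> x ^ 5" "1 \<le> x ^ 2"
    using x power_increasing[of 1 5 x] power_increasing[of 2 5 x] power_increasing[of 3 5 x] by auto
  have "real c = 4 * (real m + real n) ^ 3" by (simp add: c_def)
  also have "\<dots> \<le> 4 * x ^ 3" using assms by (intro mult_left_mono power_mono) (auto simp: x_def)
  finally have c: "real c \<le> 4 * x ^ 3" .
  \<comment> \<open>Rounding up adds at most 1, which is covered by the summand
    \<open>m \<ge> 1\<close> of \<open>x\<close>.\<close>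
  have \<kappa>: "real (nat \<lceil>\<kappa>\<rceil>) \<le> x" using assms unfolding x_def by linarith
  have "\<kappa> * L \<le> x * x" using x assms by (intro mult_mono) auto
  then have "real (nat \<lceil>64 * \<kappa> * L\<rceil>) \<le> 65 * x ^ 2"
    using pow assms by (simp add: power2_eq_square) linarith
  then have "real (nat \<lceil>64 * \<kappa> * L\<rceil>) * (1 + 16 * real c) \<le> 65 * x ^ 2 * (1 + 16 * (4 * x ^ 3))"
    using c x by (intro mult_mono) auto
  also have "\<dots> = 65 * x ^ 2 + 4160 * x ^ 5" by (simp add: algebra_simps flip: power_add)
  finally show ?thesis using c \<kappa> pow x unfolding x_def[symmetric] by (simp add: distrib_left)
qed

theorem theorem1p2:
  shows "\<exists>C>(0::real). \<exists>P. \<exists>c d :: nat.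
    \<forall>(m::nat) (n::nat) (r::nat) (f :: real mat \<Rightarrow> real) (f' :: real mat \<Rightarrow> real mat)
      (\<alpha>::real) (\<beta>::real) (\<kappa>::real) (\<epsilon>::real) (Astar :: real mat) (E :: oracles).
      m \<ge> 1 \<and> n \<ge> 1 \<and> r \<ge> 1 \<and>
      gradient_of m n f f' \<and> convex_fun m n f \<and>
      \<alpha> > 0 \<and> smooth_fun m n f f' \<beta> \<and> strongly_convex_fun m n f f' \<alpha> \<and> \<kappa> = \<beta> / \<alpha> \<and>
      \<epsilon> > 0 \<and>
      Astar \<in> carrier_mat m n \<and> vec_space.rank m Astar \<le> r \<and>
      valid_oracles m n f f' \<beta> E
      \<longrightarrow>
      (let L = log_gap (f (0\<^sub>m m n) - f Astar) \<epsilon> in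
       \<exists>t s. run E P (init_state m n r \<alpha> \<beta> \<epsilon> (f Astar)) t s \<and>
         real t \<le> real c * (real m + real n + \<kappa> + L) ^ d \<and>
         result_mat s \<in> carrier_mat m n \<and>
         real (vec_space.rank m (result_mat s)) \<le> C * real r * (\<kappa> + L) \<and>
         f (result_mat s) \<le> f Astar + \<epsilon>)"
proof (intro exI conjI allI impI)
  \<comment> \<open>The rank is at most \<open>2 r + 160 K r\<close> with
    \<open>K \<le> 2 \<kappa>\<close>, because \<open>\<kappa> \<ge> 1\<close>; this gives
    \<open>(2 + 320) \<kappa> r\<close>. Adding the nonnegative logarithm only weakens the
    bound.\<close>
  show "(0::real) < 322" by simp
  fix m n r :: nat and f :: "real mat \<Rightarrow> real" and f' :: "real mat \<Rightarrow> real mat"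
    and \<alpha> \<beta> \<kappa> \<epsilon> :: real and Astar :: "real mat" and E :: oracles
  assume "m \<ge> 1 \<and> n \<ge> 1 \<and> r \<ge> 1 \<and>
      gradient_of m n f f' \<and> convex_fun m n f \<and>
      \<alpha> > 0 \<and> smooth_fun m n f f' \<beta> \<and> strongly_convex_fun m n f f' \<alpha> \<and> \<kappa> = \<beta> / \<alpha> \<and>
      \<epsilon> > 0 \<and>
      Astar \<in> carrier_mat m n \<and> vec_space.rank m Astar \<le> r \<and>
      valid_oracles m n f f' \<beta> E"
  then have mn: "m \<ge> 1" "n \<ge> 1" and r: "r \<ge> 1" and grad: "gradient_of m n f f'"
    and f: "smooth_fun m n f f' \<beta>" "strongly_convex_fun m n f f' \<alpha>" and \<alpha>: "\<alpha> > 0"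
    and \<kappa>: "\<kappa> = \<beta> / \<alpha>" and \<epsilon>: "\<epsilon> > 0" and E: "valid_oracles m n f f' \<beta> E"
    and Astar: "factors_through m n r Astar"
    using factors_through_of_rank_le by auto
  have \<alpha>\<beta>: "\<alpha> \<le> \<beta>" by (rule smoothness_ge_strong_convexity[OF mn f])
  then have \<kappa>1: "1 \<le> \<kappa>" using \<alpha> by (simp add: \<kappa>)
  define L where "L = log_gap (f (0\<^sub>m m n) - f Astar) \<epsilon>"
  have L: "0 \<le> L" unfolding L_def by (rule log_gap_nonneg[OF \<epsilon>])
  define c where "c = 4 * (m + n) ^ 3"
  obtain t s K where run: "run E descent_algorithm (init_state m n r \<alpha> \<beta> \<epsilon> (f Astar)) t s"
    and t: "t \<le> c + (1 + nat \<lceil>\<kappa>\<rceil> * 3) + 5 * c + (1 + m * 3) + (1 + nat \<lceil>64 * \<kappa> * L\<rceil> * (1 + 16 * c))"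
    and K: "K \<le> nat \<lceil>\<kappa>\<rceil>" and low: "factors_through m n (2 * r + 160 * (K * r)) (result_mat s)"
    and opt: "f (result_mat s) \<le> f Astar + \<epsilon>"
    using descent_algorithm_achieves[OF E grad f \<alpha> \<alpha>\<beta> r \<epsilon> mn(1) Astar]
    unfolding achieves_def \<kappa>[symmetric] L_def[symmetric] c_def[symmetric] by blast
  have "real t \<le> 5000 * (real m + real n + \<kappa> + L) ^ 5"
    using descent_cost_polynomial[OF mn(1) \<kappa>1 L, of n, folded c_def] of_nat_mono[OF t, where 'a = real]
    by linarith
  moreover have "real (vec_space.rank m (result_mat s)) \<le> 322 * real r * (\<kappa> + L)"
  proof -
    have "real K \<le> 2 * \<kappa>" using K \<kappa>1 by linarith
    then have "160 * (real K * real r) \<le> 160 * ((2 * \<kappa>) * real r)" by (intro mult_left_mono mult_right_mono) auto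
    moreover have "2 * real r \<le> 2 * (\<kappa> * real r)" using mult_right_mono[OF \<kappa>1, of "real r"] by simp
    moreover have "0 \<le> real r * L" using L by simp
    moreover have "real (vec_space.rank m (result_mat s)) \<le> real (2 * r + 160 * (K * r))"
      using rank_le_of_factors_through[OF low] by (rule of_nat_mono)
    ultimately show ?thesis by (simp add: algebra_simps)
  qed
  ultimately show "let L = log_gap (f (0\<^sub>m m n) - f Astar) \<epsilon> in
       \<exists>t s. run E descent_algorithm (init_state m n r \<alpha> \<beta> \<epsilon> (f Astar)) t s \<and>
         real t \<le> real (5000::nat) * (real m + real n + \<kappa> + L) ^ 5 \<and>
         result_mat s \<in> carrier_mat m n \<and>
         real (vec_space.rank m (result_mat s)) \<le> 322 * real r * (\<kappa> + L) \<and>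
         f (result_mat s) \<le> f Astar + \<epsilon>"
    using run opt factors_through_carrier[OF low] unfolding Let_def L_def[symmetric]
    by (intro exI[of _ t] exI[of _ s]) simp
qed

end
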